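(* For every real $t$ (where at $t=0$ the right-hand sides are read as their limits as $t\to 0$) the following three identities hold, and in each of them the common value of the two sides is, as a function of $t$, a Lévy exponent: \begin{align*} (i)\quad & \int_0^\infty(\cos(tx)-1)\,\frac{\pi}{2}\,\mathrm{csch}^2\!\Big(\frac{\pi x}{2}\Big)\,dx = 1- t \coth(t);\\ (ii)\quad & \int_0^\infty (\cos(tx)-1)\,\frac{\pi}{2}\,\mathrm{csch}^{2}\!\Big(\frac{\pi x}{2}\Big)\Big(\pi x\coth\Big(\frac{\pi x}{2}\Big)-1\Big)dx = t^2\,\mathrm{csch}^2(t)-t\coth(t);\\ (iii)\quad & \int_{0}^\infty(\cos(tx)-1)\,\frac{\pi}{4}\, \mathrm{csch}^2\!\Big(\frac{\pi x}{2}\Big)\Big[2\pi^2 x^2\coth^{2}\Big(\frac{\pi x}{2}\Big) + \pi^2 x^2\,\mathrm{csch}^2\!\Big(\frac{\pi x}{2}\Big) -6\pi x\coth\Big(\frac{\pi x}{2}\Big)+2\Big]dx\\ & \qquad = 3t^2\,\mathrm{csch}^2(t)-t\coth(t)\big(2t^2\,\mathrm{csch}^2(t)+1\big). \end{align*}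
   Context: Here $\mathrm{csch}(u)=1/\sinh(u)$ and $\coth(u)=\cosh(u)/\sinh(u)$. A Lévy exponent is a function $t\mapsto \log\phi(t)$, where $\phi$ is the characteristic function of an infinitely divisible probability distribution on $\mathbb{R}$. (The identities are associated with the selfdecomposable characteristic function $t/\sinh(t)$.) *)

theory Defs
  imports "HOL-Probability.Probability"
begin

definition csch :: "real \<Rightarrow> real" where
  "csch u = 1 / sinh u"

definition coth :: "real \<Rightarrow> real" where
  "coth u = cosh u / sinh u"

primrec conv_pow :: "real measure \<Rightarrow> nat \<Rightarrow> real measure" where
  "conv_pow N 0 = return borel 0"
| "conv_pow N (Suc n) = convolution N (conv_pow N n)"

definition infinitely_divisible :: "real measure \<Rightarrow> bool" where
  "infinitely_divisible M \<longleftrightarrow>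
     real_distribution M \<and>
     (\<forall>n\<ge>1. \<exists>N. real_distribution N \<and> M = conv_pow N n)"

(* The characteristic function of an infinitely divisible law has no zeros, so it has a unique
   continuous logarithm vanishing at 0; this is the branch meant by log phi. *)
definition levy_exponent :: "(real \<Rightarrow> complex) \<Rightarrow> bool" where
  "levy_exponent \<psi> \<longleftrightarrow>
     continuous_on UNIV \<psi> \<and> \<psi> 0 = 0 \<and>
     (\<exists>M. infinitely_divisible M \<and> (\<forall>t. char M t = exp (\<psi> t)))"

(* Lim is unspecified where no limit exists, so uses of this operator should be accompanied by
   a proof that f converges at 0. *)
definition lim_at_0 :: "(real \<Rightarrow> real) \<Rightarrow> real \<Rightarrow> real" where
  "lim_at_0 f t = (if t = 0 then Lim (at 0) f else f t)"

end

theory Submission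
  imports Defs
begin

text \<open>
For a jump density \<open>k\<close> on \<open>(0, \<infinity>)\<close> let \<open>levy_integral k t\<close> be the integral of
\<open>(cos (t * x) - 1) * k x\<close>. It converges as soon as \<open>x\<^sup>2 * k x\<close> is integrable.

\<^emph>\<open>The identities.\<close> For \<open>k x = pi / 2 * (csch (pi * x / 2))\<^sup>2\<close>, expand the density into the series of
\<open>2 * pi * n * exp (- (pi * n * x))\<close>. Each term integrates to \<open>- 2 * t\<^sup>2 / (t\<^sup>2 + (pi * n)\<^sup>2)\<close>, and the
sum is \<open>1 - t * coth t\<close> by the partial fraction expansion of the hyperbolic cotangent
(\<open>levy_integral_csch_square\<close>). The other two identities follow without further integrals: applying
\<open>t * d/dt\<close> to the exponent corresponds to replacing \<open>k\<close> by \<open>- (x * k)'\<close> (\<open>levy_integral_dilation\<close>),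
and one application of these two operations leads from each identity to the next.

\<^emph>\<open>The Levy exponents.\<close> If in addition \<open>k\<close> is nonnegative, then \<open>exp (levy_integral k t)\<close> is the
characteristic function of an infinitely divisible law (\<open>levy_exponent_levy_integral\<close>). It is a
limit of characteristic functions of convolution powers of laws with most of their mass at \<open>0\<close>; the
second moments of these powers are bounded by the integral of \<open>x\<^sup>2 * k x\<close>, so they form a tight
family. Applied to \<open>k / n\<close>, the same construction yields convolution roots.

It remains to see that the three densities are nonnegative and decay. Only the positivity of the
third one is not evident. With \<open>y = pi * x / 2\<close> and \<open>c = y * coth y\<close> it amounts to
\<open>12 * c\<^sup>2 - 4 * y\<^sup>2 - 12 * c + 2 \<ge> 0\<close>, which follows from \<open>y / sinh y \<ge> 1 - y\<^sup>2 / 6\<close>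
(\<open>jump_polynomial_nonneg\<close>).
\<close>


section \<open>Exponents given by a symmetric jump density\<close>

definition levy_integral :: "(real \<Rightarrow> real) \<Rightarrow> real \<Rightarrow> real" where
  "levy_integral k t = (LBINT x:{0<..}. (cos (t * x) - 1) * k x)"

text \<open>Half the difference of the squares, rather than of the arguments, is the bound that carries
everything below: it gains a second power of the jump size \<open>x\<close>, which is what makes integrals
against a density with a double pole at \<open>0\<close> converge, uniformly in difference quotients in \<open>t\<close>.\<close>

lemma abs_cos_diff_le: "\<bar>cos a - cos b\<bar> \<le> \<bar>a\<^sup>2 - b\<^sup>2\<bar> / 2" for a b :: real
proof -
  have "\<bar>cos a - cos b\<bar> = 2 * (\<bar>sin ((a + b) / 2)\<bar> * \<bar>sin ((b - a) / 2)\<bar>)"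
    by (simp add: cos_diff_cos abs_mult)
  also have "\<dots> \<le> 2 * (\<bar>(a + b) / 2\<bar> * \<bar>(b - a) / 2\<bar>)"
    by (intro mult_left_mono mult_mono abs_sin_x_le_abs_x) auto
  also have "\<dots> = \<bar>(a + b) * (b - a)\<bar> / 2"
    by (simp add: abs_mult)
  also have "(a + b) * (b - a) = - (a\<^sup>2 - b\<^sup>2)"
    by (simp add: power2_eq_square algebra_simps)
  finally show ?thesis by simp
qed

lemma abs_cos_minus_one_le: "\<bar>cos (t * x) - 1\<bar> \<le> t\<^sup>2 / 2 * x\<^sup>2" for t x :: real
  using abs_cos_diff_le[of "t * x" 0] by (simp add: power_mult_distrib)

text \<open>As \<open>x\<^sup>2\<close> does not vanish on \<open>(0, \<infinity>)\<close>, measurability of the density can be recovered from that of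
\<open>x\<^sup>2 * k x\<close>.\<close>

lemma borel_measurable_jump_density:
  fixes k :: "real \<Rightarrow> real"
  assumes "set_integrable lborel {0<..} (\<lambda>x. x\<^sup>2 * k x)"
  shows "(\<lambda>x. indicator {0<..} x * k x) \<in> borel_measurable (borel :: real measure)"
proof -
  have "(\<lambda>x. indicator {0<..} x *\<^sub>R (x\<^sup>2 * k x)) \<in> borel_measurable lborel"
    using assms unfolding set_integrable_def by (rule borel_measurable_integrable)
  then have "(\<lambda>x. (indicator {0<..} x *\<^sub>R (x\<^sup>2 * k x)) / x\<^sup>2) \<in> borel_measurable borel"
    by (intro borel_measurable_divide) auto
  also have "(\<lambda>x. (indicator {0<..} x *\<^sub>R (x\<^sup>2 * k x)) / x\<^sup>2) = (\<lambda>x. indicator {0<..} x * k x)"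
    by (auto simp: indicator_def)
  finally show ?thesis .
qed

lemma set_integrable_jump_bound:
  fixes g k :: "real \<Rightarrow> real"
  assumes k: "set_integrable lborel {0<..} (\<lambda>x. x\<^sup>2 * k x)"
    and [measurable]: "g \<in> borel_measurable borel"
    and g: "\<And>x. x > 0 \<Longrightarrow> \<bar>g x\<bar> \<le> c * x\<^sup>2"
  shows "set_integrable lborel {0<..} (\<lambda>x. g x * k x)"
  unfolding set_integrable_def
proof (rule Bochner_Integration.integrable_bound)
  note [measurable] = borel_measurable_jump_density[OF k]
  show "integrable lborel (\<lambda>x. c * (indicator {0<..} x *\<^sub>R (x\<^sup>2 * k x)))"
    using k by (auto simp: set_integrable_def)
  have "(\<lambda>x. g x * (indicator {0<..} x * k x)) \<in> borel_measurable lborel"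
    by measurable
  then show "(\<lambda>x. indicator {0<..} x *\<^sub>R (g x * k x)) \<in> borel_measurable lborel"
    by (simp add: mult_ac)
  have "\<bar>g x\<bar> * \<bar>k x\<bar> \<le> \<bar>c * (x\<^sup>2 * k x)\<bar>" if "x > 0" for x
  proof -
    have "\<bar>g x\<bar> * \<bar>k x\<bar> \<le> (c * x\<^sup>2) * \<bar>k x\<bar>"
      using g[OF that] by (intro mult_right_mono) auto
    also have "\<dots> \<le> (\<bar>c\<bar> * x\<^sup>2) * \<bar>k x\<bar>"
      by (intro mult_right_mono) auto
    also have "\<dots> = \<bar>c * (x\<^sup>2 * k x)\<bar>"
      by (simp add: abs_mult)
    finally show ?thesis .
  qed
  then show "AE x in lborel. norm (indicator {0<..} x *\<^sub>R (g x * k x))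
      \<le> norm (c * (indicator {0<..} x *\<^sub>R (x\<^sup>2 * k x)))"
    by (intro AE_I2) (auto simp: indicator_def abs_mult)
qed

lemma set_integrable_levy:
  fixes k :: "real \<Rightarrow> real"
  assumes "set_integrable lborel {0<..} (\<lambda>x. x\<^sup>2 * k x)"
  shows "set_integrable lborel {0<..} (\<lambda>x. (cos (t * x) - 1) * k x)"
  using assms by (rule set_integrable_jump_bound[where c = "t\<^sup>2 / 2"])
     (use abs_cos_minus_one_le in simp_all)

text \<open>Differentiation under the integral sign. The difference quotients in \<open>t\<close> are dominated by a
multiple of \<open>x\<^sup>2 * \<bar>k x\<bar>\<close>.\<close>

lemma has_real_derivative_levy_integral:
  fixes k :: "real \<Rightarrow> real"
  assumes k: "set_integrable lborel {0<..} (\<lambda>x. x\<^sup>2 * k x)"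
  shows "(levy_integral k has_real_derivative - (LBINT x:{0<..}. (x * sin (t * x)) * k x)) (at t)"
  unfolding DERIV_def tendsto_at_iff_sequentially
proof (intro allI impI)
  fix X :: "nat \<Rightarrow> real"
  assume nz: "\<forall>i. X i \<in> UNIV - {0}" and X: "X \<longlonglongrightarrow> 0"
  note [measurable] = borel_measurable_jump_density[OF k]
  \<comment> \<open>a null sequence is bounded, which makes the dominating function independent of the index\<close>
  obtain K where K: "\<And>i. \<bar>X i\<bar> \<le> K"
    using X convergent_imp_Bseq[of X] by (auto simp: convergent_def Bseq_def)
  let ?k = "\<lambda>x. indicator {0<..} x * k x"
  have quot: "(levy_integral k (t + h) - levy_integral k t) / h =
      (\<integral>x. (cos ((t + h) * x) - cos (t * x)) / h * ?k x \<partial>lborel)" for h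
  proof -
    have "levy_integral k (t + h) - levy_integral k t =
        (LBINT x:{0<..}. (cos ((t + h) * x) - 1) * k x - (cos (t * x) - 1) * k x)"
      unfolding levy_integral_def
      by (intro set_integral_diff(2)[symmetric] set_integrable_levy k)
    then show ?thesis
      by (simp add: set_lebesgue_integral_def algebra_simps diff_divide_distrib flip: integral_divide_zero)
  qed
  have "(\<lambda>i. \<integral>x. (cos ((t + X i) * x) - cos (t * x)) / X i * ?k x \<partial>lborel)
      \<longlonglongrightarrow> (\<integral>x. - (x * sin (t * x)) * ?k x \<partial>lborel)"
  proof (rule integral_dominated_convergence)
    show "integrable lborel (\<lambda>x. (\<bar>t\<bar> + K) * \<bar>indicator {0<..} x *\<^sub>R (x\<^sup>2 * k x)\<bar>)"
      using k by (auto simp: set_integrable_def)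
    show "AE x in lborel. (\<lambda>i. (cos ((t + X i) * x) - cos (t * x)) / X i * ?k x)
        \<longlonglongrightarrow> - (x * sin (t * x)) * ?k x"
    proof (intro AE_I2 tendsto_mult tendsto_const)
      fix x
      have "((\<lambda>t. cos (t * x)) has_real_derivative - (x * sin (t * x))) (at t)"
        by (auto intro!: derivative_eq_intros)
      then show "(\<lambda>i. (cos ((t + X i) * x) - cos (t * x)) / X i) \<longlonglongrightarrow> - (x * sin (t * x))"
        using nz X unfolding DERIV_def tendsto_at_iff_sequentially by (auto simp: o_def)
    qed
    fix i
    show "AE x in lborel. norm ((cos ((t + X i) * x) - cos (t * x)) / X i * ?k x)
        \<le> (\<bar>t\<bar> + K) * \<bar>indicator {0<..} x *\<^sub>R (x\<^sup>2 * k x)\<bar>"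
    proof (intro AE_I2)
      fix x
      let ?h = "X i"
      have h: "?h \<noteq> 0" using nz by auto
      have "\<bar>cos ((t + ?h) * x) - cos (t * x)\<bar> \<le> \<bar>((t + ?h) * x)\<^sup>2 - (t * x)\<^sup>2\<bar> / 2"
        by (rule abs_cos_diff_le)
      also have "((t + ?h) * x)\<^sup>2 - (t * x)\<^sup>2 = ?h * ((2 * t + ?h) * x\<^sup>2)"
        by (simp add: power2_eq_square algebra_simps)
      also have "\<bar>\<dots>\<bar> / 2 = \<bar>?h\<bar> * (\<bar>2 * t + ?h\<bar> / 2 * x\<^sup>2)"
        by (simp add: abs_mult)
      also have "\<dots> \<le> \<bar>?h\<bar> * ((\<bar>t\<bar> + K) * x\<^sup>2)"
        using K[of i] by (intro mult_left_mono mult_right_mono) auto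
      finally have "\<bar>(cos ((t + ?h) * x) - cos (t * x)) / ?h\<bar> \<le> (\<bar>t\<bar> + K) * x\<^sup>2"
        using h by (simp add: field_simps)
      then have "\<bar>(cos ((t + ?h) * x) - cos (t * x)) / ?h\<bar> * \<bar>?k x\<bar> \<le> (\<bar>t\<bar> + K) * x\<^sup>2 * \<bar>?k x\<bar>"
        by (intro mult_right_mono) auto
      then show "norm ((cos ((t + ?h) * x) - cos (t * x)) / ?h * ?k x)
          \<le> (\<bar>t\<bar> + K) * \<bar>indicator {0<..} x *\<^sub>R (x\<^sup>2 * k x)\<bar>"
        by (simp add: abs_mult mult_ac)
    qed
  qed measurable
  also have "(\<integral>x. - (x * sin (t * x)) * ?k x \<partial>lborel) = - (LBINT x:{0<..}. (x * sin (t * x)) * k x)"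
    by (simp add: set_lebesgue_integral_def mult_ac flip: Bochner_Integration.integral_minus)
  finally show "((\<lambda>h. (levy_integral k (t + h) - levy_integral k t) / h) \<circ> X) \<longlonglongrightarrow>
      - (LBINT x:{0<..}. (x * sin (t * x)) * k x)"
    by (simp add: o_def quot)
qed

text \<open>Scaling the jumps by \<open>s\<close> replaces \<open>t\<close> by \<open>s * t\<close> in the exponent and \<open>k x\<close> by \<open>k (x / s) / s\<close> in the
density. Differentiating in \<open>s\<close> at \<open>1\<close> shows that \<open>t * d/dt\<close> acts on exponents as \<open>k \<mapsto> - (x * k)'\<close> acts
on densities. The proof is an integration by parts, in which the bound on \<open>x\<^sup>2 * \<bar>k x\<bar>\<close> kills the
boundary terms: \<open>(cos (t * x) - 1) * x * k x\<close> is \<open>O(x)\<close> at \<open>0\<close> and \<open>O(1 / x)\<close> at \<open>\<infinity>\<close>.\<close>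

lemma levy_integral_dilation:
  fixes k :: "real \<Rightarrow> real"
  assumes k: "set_integrable lborel {0<..} (\<lambda>x. x\<^sup>2 * k x)"
    and l: "set_integrable lborel {0<..} (\<lambda>x. x\<^sup>2 * l x)"
    and deriv: "\<And>x. x > 0 \<Longrightarrow> ((\<lambda>x. x * k x) has_real_derivative - l x) (at x)"
    and cont: "\<And>x. x > 0 \<Longrightarrow> isCont l x"
    and bound: "\<And>x. x > 0 \<Longrightarrow> x\<^sup>2 * \<bar>k x\<bar> \<le> C"
    and D: "(levy_integral k has_real_derivative D) (at t)"
  shows "levy_integral l t = t * D"
proof -
  define f where "f x = (cos (t * x) - 1) * l x + t * ((x * sin (t * x)) * k x)" for x
  define G where "G x = (1 - cos (t * x)) * (x * k x)" for x
  have kx: "set_integrable lborel {0<..} (\<lambda>x. (x * sin (t * x)) * k x)"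
  proof (rule set_integrable_jump_bound[OF k, where c = "\<bar>t\<bar>"])
    show "\<bar>x * sin (t * x)\<bar> \<le> \<bar>t\<bar> * x\<^sup>2" for x
    proof -
      have "\<bar>x * sin (t * x)\<bar> \<le> \<bar>x\<bar> * \<bar>t * x\<bar>"
        unfolding abs_mult by (intro mult_left_mono) (simp_all add: abs_sin_x_le_abs_x flip: abs_mult)
      then show ?thesis by (simp add: abs_mult power2_eq_square mult_ac)
    qed
  qed auto
  have f_int: "set_integrable lborel {0<..} f"
    unfolding f_def using kx by (intro set_integral_add(1) set_integrable_levy l) auto
  have bnd: "\<bar>x * k x\<bar> \<le> C / x" if "x > 0" for x
    using bound[OF that] that by (simp add: abs_mult field_simps power2_eq_square)
  have "C \<ge> 0" using bound[of 1] by simp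
  have "(LBINT x=0..\<infinity>. f x) = 0 - 0"
  proof (rule interval_integral_FTC_integrable)
    fix x :: real assume "0 < ereal x"
    then have x: "x > 0" by simp
    \<comment> \<open>continuity of the density is read off from the differentiability of its product with the variable\<close>
    have "isCont k x"
    proof -
      have "isCont (\<lambda>x. x * k x) x" using deriv[OF x] by (rule DERIV_isCont)
      then have "isCont (\<lambda>x. x * k x / x) x" using x by (intro isCont_divide continuous_ident) auto
      moreover have "eventually (\<lambda>y. y \<in> {0<..}) (nhds x)"
        using x by (intro eventually_nhds_in_open) auto
      then have "eventually (\<lambda>y. y * k y / y = k y) (nhds x)"
        by (rule eventually_mono) simp
      ultimately show ?thesis by (subst (asm) isCont_cong)
    qed
    then show "isCont f x"
      unfolding f_def using cont[OF x] by (intro continuous_intros) auto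
    have "((\<lambda>x. 1 - cos (t * x)) has_real_derivative t * sin (t * x)) (at x)"
      by (auto intro!: derivative_eq_intros)
    from DERIV_mult[OF this deriv[OF x]] show "(G has_vector_derivative f x) (at x)"
      unfolding has_real_derivative_iff_has_vector_derivative[symmetric] G_def f_def
      by (simp add: algebra_simps)
  next
    show "set_integrable lborel (einterval 0 \<infinity>) f"
      using f_int by (simp add: einterval_def greaterThan_def)
    have "(G \<longlongrightarrow> 0) (at_right 0)"
    proof (rule Lim_null_comparison)
      show "\<forall>\<^sub>F x in at_right 0. norm (G x) \<le> t\<^sup>2 / 2 * C * x"
        unfolding eventually_at_right_field
      proof (intro exI[of _ 1] conjI allI impI)
        fix x :: real assume x: "0 < x"
        have "\<bar>G x\<bar> \<le> (t\<^sup>2 / 2 * x\<^sup>2) * (C / x)"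
          unfolding G_def abs_mult[of "1 - _"] using abs_cos_minus_one_le[of t x] bnd[OF x]
          by (intro mult_mono) (auto simp: abs_minus_commute)
        also have "\<dots> = t\<^sup>2 / 2 * C * x" using x by (simp add: power2_eq_square)
        finally show "norm (G x) \<le> t\<^sup>2 / 2 * C * x" by simp
      qed auto
      show "((\<lambda>x. t\<^sup>2 / 2 * C * x) \<longlongrightarrow> 0) (at_right 0)"
        by (auto intro!: tendsto_eq_intros)
    qed
    then show "((G \<circ> real_of_ereal) \<longlongrightarrow> 0) (at_right 0)"
      by (simp add: zero_ereal_def ereal_tendsto_simps)
    have "(G \<longlongrightarrow> 0) at_top"
    proof (rule Lim_null_comparison)
      show "\<forall>\<^sub>F x in at_top. norm (G x) \<le> 2 * (C / x)"
        using eventually_gt_at_top[of 0]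
      proof eventually_elim
        fix x :: real assume x: "0 < x"
        show "norm (G x) \<le> 2 * (C / x)"
          unfolding G_def norm_mult[of "1 - _"] 
        proof (rule mult_mono)
          show "norm (1 - cos (t * x)) \<le> 2"
            using cos_ge_minus_one[of "t * x"] cos_le_one[of "t * x"] by (simp del: cos_ge_minus_one cos_le_one)
        qed (use bnd[OF x] in auto)
      qed
      show "((\<lambda>x. 2 * (C / x)) \<longlongrightarrow> 0) at_top"
        by real_asymp
    qed
    then show "((G \<circ> real_of_ereal) \<longlongrightarrow> 0) (at_left \<infinity>)"
      by (simp add: ereal_tendsto_simps)
  qed auto
  then have "0 = (LBINT x:{0<..}. f x)"
    by (simp add: interval_lebesgue_integral_def einterval_def greaterThan_def)
  also have "\<dots> = levy_integral l t + t * (LBINT x:{0<..}. (x * sin (t * x)) * k x)"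
    unfolding f_def levy_integral_def using kx set_integrable_levy[OF l]
    by (subst set_integral_add(2)) auto
  also have "(LBINT x:{0<..}. (x * sin (t * x)) * k x) = - D"
    using DERIV_unique[OF D has_real_derivative_levy_integral[OF k]] by simp
  finally show ?thesis by simp
qed

section \<open>Convolution powers and limits of laws\<close>

lemma real_distribution_convolution:
  assumes "real_distribution M" "real_distribution N"
  shows "real_distribution (convolution M N)"
proof -
  interpret M: real_distribution M by fact
  interpret N: real_distribution N by fact
  interpret pair_prob_space M N ..
  have "(\<lambda>(x, y). x + y) \<in> M \<Otimes>\<^sub>M N \<rightarrow>\<^sub>M borel" by measurable
  then have "prob_space (convolution M N)"
    unfolding convolution_def by (rule prob_space_distr)
  then show ?thesis
    by (simp add: real_distribution_def real_distribution_axioms_def)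
qed

text \<open>A convolution is the law of the sum of the two coordinates under the product measure. That the
coordinates are independent with the given marginals turns statements about sums of independent
random variables into statements about convolutions.\<close>

lemma indep_var_coordinates:
  assumes "real_distribution M" "real_distribution N"
  shows "prob_space.indep_var (M \<Otimes>\<^sub>M N) borel fst borel snd"
    and "distr (M \<Otimes>\<^sub>M N) borel fst = M" and "distr (M \<Otimes>\<^sub>M N) borel snd = N"
proof -
  interpret M: real_distribution M by fact
  interpret N: real_distribution N by fact
  interpret pair_prob_space M N ..
  have "distr (M \<Otimes>\<^sub>M N) borel fst = distr (M \<Otimes>\<^sub>M N) M fst"
    by (intro distr_cong) auto
  then show 1: "distr (M \<Otimes>\<^sub>M N) borel fst = M"
    by (simp add: N.distr_pair_fst)
  have "distr (M \<Otimes>\<^sub>M N) borel snd = N"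
  proof (rule measure_eqI)
    fix A assume "A \<in> sets (distr (M \<Otimes>\<^sub>M N) borel snd)"
    then have A: "A \<in> sets borel" by simp
    then have "emeasure (distr (M \<Otimes>\<^sub>M N) borel snd) A = emeasure (M \<Otimes>\<^sub>M N) (space M \<times> A)"
      by (auto simp: emeasure_distr space_pair_measure intro!: arg_cong2[where f = emeasure])
    also have "\<dots> = emeasure N A"
      using A by (simp add: N.emeasure_pair_measure_Times M.emeasure_space_1[simplified])
    finally show "emeasure (distr (M \<Otimes>\<^sub>M N) borel snd) A = emeasure N A" .
  qed simp
  then show 2: "distr (M \<Otimes>\<^sub>M N) borel snd = N" .
  have "distr (M \<Otimes>\<^sub>M N) (borel \<Otimes>\<^sub>M borel) (\<lambda>x. (fst x, snd x)) = distr (M \<Otimes>\<^sub>M N) (M \<Otimes>\<^sub>M N) (\<lambda>x. x)"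
    by (intro distr_cong sets_pair_measure_cong) auto
  then show "indep_var borel fst borel snd"
    by (subst indep_var_distribution_eq) (simp add: 1 2 distr_id)
qed

lemma char_convolution:
  assumes "real_distribution M" "real_distribution N"
  shows "char (convolution M N) t = char M t * char N t"
proof -
  interpret M: real_distribution M by fact
  interpret N: real_distribution N by fact
  interpret pair_prob_space M N ..
  note c = indep_var_coordinates[OF assms]
  have "char (distr (M \<Otimes>\<^sub>M N) borel (\<lambda>x. fst x + snd x)) t =
      char (distr (M \<Otimes>\<^sub>M N) borel fst) t * char (distr (M \<Otimes>\<^sub>M N) borel snd) t"
    using c(1) by (rule char_distr_add)
  then show ?thesis
    by (simp add: convolution_def c case_prod_unfold)
qed

text \<open>Centring is included because it is what makes second moments additive under convolution.\<close>

definition centred_second_moment :: "real measure \<Rightarrow> real \<Rightarrow> bool" where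
  "centred_second_moment M v \<longleftrightarrow> real_distribution M \<and>
     has_bochner_integral M (\<lambda>x. x) 0 \<and> has_bochner_integral M (\<lambda>x. x\<^sup>2) v"

lemma centred_second_moment_convolution:
  assumes "centred_second_moment M v" "centred_second_moment N w"
  shows "centred_second_moment (convolution M N) (v + w)"
proof -
  have M: "real_distribution M" and N: "real_distribution N"
    using assms by (auto simp: centred_second_moment_def)
  interpret M: real_distribution M by fact
  interpret N: real_distribution N by fact
  interpret pair_prob_space M N ..
  note c = indep_var_coordinates[OF M N]
  have fst: "has_bochner_integral (M \<Otimes>\<^sub>M N) (\<lambda>z. f (fst z)) y"
    if "has_bochner_integral M f y" for f :: "real \<Rightarrow> real" and y
  proof -
    have [measurable]: "f \<in> borel_measurable borel"
      using borel_measurable_has_bochner_integral[OF that] by simp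
    have [measurable]: "fst \<in> M \<Otimes>\<^sub>M N \<rightarrow>\<^sub>M borel"
      by measurable
    have "has_bochner_integral (distr (M \<Otimes>\<^sub>M N) borel fst) f y"
      using that by (simp only: c)
    then show ?thesis
      by (simp add: has_bochner_integral_iff integrable_distr_eq integral_distr)
  qed
  have snd: "has_bochner_integral (M \<Otimes>\<^sub>M N) (\<lambda>z. f (snd z)) y"
    if "has_bochner_integral N f y" for f :: "real \<Rightarrow> real" and y
  proof -
    have [measurable]: "f \<in> borel_measurable borel"
      using borel_measurable_has_bochner_integral[OF that] by simp
    have [measurable]: "snd \<in> M \<Otimes>\<^sub>M N \<rightarrow>\<^sub>M borel"
      by measurable
    have "has_bochner_integral (distr (M \<Otimes>\<^sub>M N) borel snd) f y"
      using that by (simp only: c)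
    then show ?thesis
      by (simp add: has_bochner_integral_iff integrable_distr_eq integral_distr)
  qed
  have "has_bochner_integral (M \<Otimes>\<^sub>M N) (\<lambda>z. fst z) 0" "has_bochner_integral (M \<Otimes>\<^sub>M N) (\<lambda>z. snd z) 0"
    using assms fst[of "\<lambda>x. x"] snd[of "\<lambda>x. x"] by (auto simp: centred_second_moment_def)
  note m1 = this
  have m2: "has_bochner_integral (M \<Otimes>\<^sub>M N) (\<lambda>z. (fst z)\<^sup>2) v"
      "has_bochner_integral (M \<Otimes>\<^sub>M N) (\<lambda>z. (snd z)\<^sup>2) w"
    using assms fst[of "\<lambda>x. x\<^sup>2"] snd[of "\<lambda>x. x\<^sup>2"] by (auto simp: centred_second_moment_def)
  have prod: "has_bochner_integral (M \<Otimes>\<^sub>M N) (\<lambda>z. fst z * snd z) 0"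
    using indep_var_integrable[OF c(1)] indep_var_lebesgue_integral[OF c(1)] m1
    by (simp add: has_bochner_integral_iff)
  have "has_bochner_integral (M \<Otimes>\<^sub>M N) (\<lambda>z. (fst z)\<^sup>2 + (snd z)\<^sup>2 + 2 * (fst z * snd z)) (v + w + 2 * 0)"
    by (intro has_bochner_integral_add has_bochner_integral_mult_right m2 prod)
  then have sq: "has_bochner_integral (M \<Otimes>\<^sub>M N) (\<lambda>z. (fst z + snd z)\<^sup>2) (v + w)"
    by (simp add: power2_sum algebra_simps)
  have lin: "has_bochner_integral (M \<Otimes>\<^sub>M N) (\<lambda>z. fst z + snd z) 0"
    using has_bochner_integral_add[OF m1] by simp
  show ?thesis
    using sq lin real_distribution_convolution[OF M N]
    by (auto simp: centred_second_moment_def convolution_def case_prod_unfold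
        has_bochner_integral_iff integrable_distr_eq integral_distr)
qed

lemma real_distribution_return: "real_distribution (return borel 0)"
  by (simp add: real_distribution_def real_distribution_axioms_def prob_space_return)

lemma char_return_zero: "char (return borel 0) t = 1"
  by (simp add: char_def integral_return)

lemma real_distribution_conv_pow:
  "real_distribution N \<Longrightarrow> real_distribution (conv_pow N n)"
  by (induction n) (auto intro: real_distribution_return real_distribution_convolution)

lemma char_conv_pow: "real_distribution N \<Longrightarrow> char (conv_pow N n) t = char N t ^ n"
  by (induction n) (auto simp: char_return_zero char_convolution real_distribution_conv_pow)

lemma centred_second_moment_conv_pow:
  assumes "centred_second_moment N v"
  shows "centred_second_moment (conv_pow N n) (n * v)"
proof (induction n)
  case 0
  have "has_bochner_integral (return borel 0) f 0"
    if [measurable]: "f \<in> borel_measurable borel" and "f 0 = 0" for f :: "real \<Rightarrow> real"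
  proof (subst has_bochner_integral_cong_AE)
    show "AE x in return borel 0. f x = 0"
      using \<open>f 0 = 0\<close> by (simp add: AE_return)
  qed (simp_all add: has_bochner_integral_zero)
  note zero = this
  have "has_bochner_integral (return borel 0) (\<lambda>x. x) (0::real)"
    by (rule zero) auto
  moreover have "has_bochner_integral (return borel 0) (\<lambda>x. x\<^sup>2) (0::real)"
    by (rule zero) auto
  ultimately have "centred_second_moment (return borel 0) 0"
    unfolding centred_second_moment_def using real_distribution_return by blast
  then show ?case by simp
next
  case (Suc n)
  have "centred_second_moment (conv_pow N (Suc n)) (v + real n * v)"
    using centred_second_moment_convolution[OF assms Suc] by simp
  also have "v + real n * v = real (Suc n) * v"
    by (simp add: algebra_simps)
  finally show ?case .
qed

text \<open>By Chebyshev's inequality, the mass outside \<open>(-c, c]\<close> is at most \<open>V / c\<^sup>2\<close>, whatever the index.\<close>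

lemma tight_second_moment:
  assumes "\<And>n. centred_second_moment (\<mu> n) (v n)" and V: "\<And>n. v n \<le> V"
  shows "tight \<mu>"
  unfolding tight_def
proof (intro conjI allI impI)
  show "real_distribution (\<mu> n)" for n using assms by (simp add: centred_second_moment_def)
  fix e :: real assume e: "e > 0"
  \<comment> \<open>a positive bound is needed for \<open>c\<close> to be positive\<close>
  define W where "W = max V 1"
  define c where "c = sqrt (2 * W / e)"
  have "W > 0" by (simp add: W_def)
  then have c: "c > 0" "c\<^sup>2 = 2 * W / e" using e by (auto simp: c_def)
  have "measure (\<mu> n) {-c<..c} > 1 - e" for n
  proof -
    interpret real_distribution "\<mu> n" by fact
    have m: "has_bochner_integral (\<mu> n) (\<lambda>x. x\<^sup>2) (v n)"
      using assms(1)[of n] by (simp add: centred_second_moment_def)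
    have "prob {x \<in> space (\<mu> n). \<bar>x\<bar> \<ge> c} \<le> expectation (\<lambda>x. x\<^sup>2) / c\<^sup>2"
      using m c by (intro second_moment_method) (auto simp: has_bochner_integral_iff)
    also have "\<dots> \<le> W / c\<^sup>2"
    proof (rule divide_right_mono)
      have "expectation (\<lambda>x. x\<^sup>2) = v n"
        using m by (rule has_bochner_integral_integral_eq)
      then show "expectation (\<lambda>x. x\<^sup>2) \<le> W"
        using V[of n] by (simp add: W_def)
    qed simp
    also have "\<dots> < e" using c e \<open>W > 0\<close> by simp
    finally have "prob {x. \<bar>x\<bar> \<ge> c} < e" by simp
    moreover have "1 = prob {-c<..c} + prob (- {-c<..c})"
      using prob_compl[of "{-c<..c}"] by (simp add: Compl_eq_Diff_UNIV)
    moreover have "prob (- {-c<..c}) \<le> prob {x. \<bar>x\<bar> \<ge> c}"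
      by (intro finite_measure_mono) auto
    ultimately show ?thesis by linarith
  qed
  then show "\<exists>a b. a < b \<and> (\<forall>n. measure (\<mu> n) {a<..b} > 1 - e)"
    using c by (intro exI[of _ "-c"] exI[of _ c]) auto
qed

text \<open>A form of the continuity theorem in which the limit is not assumed to be a characteristic
function: the moment bound gives tightness, so by Helly's theorem a subsequence converges
weakly, and its limit law has the pointwise limit as its characteristic function.\<close>

lemma char_limit_of_bounded_second_moments:
  assumes m: "\<And>n. centred_second_moment (\<mu> n) (v n)" and V: "\<And>n. v n \<le> V"
    and lim: "\<And>t. (\<lambda>n. char (\<mu> n) t) \<longlonglongrightarrow> \<phi> t"
  obtains M where "real_distribution M" "\<And>t. char M t = \<phi> t"
proof -
  have "tight \<mu>" using m V by (rule tight_second_moment)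
  then obtain r M where r: "strict_mono (r :: nat \<Rightarrow> nat)" and M: "real_distribution M"
    and w: "weak_conv_m (\<mu> \<circ> id \<circ> r) M"
    by (rule tight_imp_convergent_subsubsequence[OF _ strict_mono_id, THEN exE]) (elim exE conjE)
  have "char M t = \<phi> t" for t
  proof (rule LIMSEQ_unique)
    show "(\<lambda>n. char ((\<mu> \<circ> id \<circ> r) n) t) \<longlonglongrightarrow> char M t"
      using m M w by (intro levy_continuity1) (auto simp: o_def centred_second_moment_def)
    show "(\<lambda>n. char ((\<mu> \<circ> id \<circ> r) n) t) \<longlonglongrightarrow> \<phi> t"
      using LIMSEQ_subseq_LIMSEQ[OF lim r] by (simp add: o_def)
  qed
  with M show thesis by (rule that)
qed

text \<open>A sub-probability density \<open>g\<close> is completed to a law by an atom at \<open>0\<close>. If \<open>g\<close> vanishes on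
\<open>(-a, a)\<close>, the missing mass can first be spread uniformly over this interval, where it does not
interfere with \<open>g\<close>, and then be collapsed to \<open>0\<close> by the map \<open>X\<close>; the law is thus the
distribution of a random variable on a space with a density.\<close>

lemma exists_law_with_density_and_atom:
  fixes g :: "real \<Rightarrow> real"
  assumes g: "integrable lborel g" "\<And>x. g x \<ge> 0" "(\<integral>x. g x \<partial>lborel) \<le> 1"
    and a: "a > 0" "\<And>x. \<bar>x\<bar> < a \<Longrightarrow> g x = 0"
  obtains N where "real_distribution N"
    "\<And>f :: real \<Rightarrow> real. f \<in> borel_measurable borel \<Longrightarrow>
       integrable lborel (\<lambda>x. g x * f x) \<Longrightarrow>
       has_bochner_integral N f ((\<integral>x. g x * f x \<partial>lborel) + (1 - (\<integral>x. g x \<partial>lborel)) * f 0)"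
proof -
  define q where "q = 1 - (\<integral>x. g x \<partial>lborel)"
  define d where "d x = g x + q / (2 * a) * indicator {-a<..<a} x" for x
  define X where "X x = (if \<bar>x\<bar> < a then 0 else x)" for x :: real
  define P where "P = density lborel d"
  have [measurable]: "g \<in> borel_measurable borel"
    using borel_measurable_integrable[OF g(1)] by simp
  have [measurable]: "d \<in> borel_measurable borel" "X \<in> borel_measurable borel"
    unfolding d_def X_def by measurable
  have q: "q \<ge> 0" using g by (simp add: q_def)
  have d: "d x \<ge> 0" for x using g q a by (auto simp: d_def)
  have key: "has_bochner_integral lborel (\<lambda>x. d x * f (X x)) ((\<integral>x. g x * f x \<partial>lborel) + q * f 0)"
    if f: "integrable lborel (\<lambda>x. g x * f x)" for f :: "real \<Rightarrow> real"
  proof -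
    have "has_bochner_integral lborel (\<lambda>x. indicator {-a<..<a} x * ((q / (2 * a)) * f 0))
        (measure lborel {-a<..<a} * ((q / (2 * a)) * f 0))"
      using a has_bochner_integral_indicator[of "{-a<..<a}" lborel "q / (2 * a) * f 0"] by simp
    also have "measure lborel {-a<..<a} * ((q / (2 * a)) * f 0) = q * f 0"
      using a by simp
    finally have "has_bochner_integral lborel
        (\<lambda>x. g x * f x + indicator {-a<..<a} x * ((q / (2 * a)) * f 0))
        ((\<integral>x. g x * f x \<partial>lborel) + q * f 0)"
      by (intro has_bochner_integral_add has_bochner_integral_integrable f)
    also have "(\<lambda>x. g x * f x + indicator {-a<..<a} x * ((q / (2 * a)) * f 0)) =
        (\<lambda>x. d x * f (X x))"
      using a(2) by (auto simp: d_def X_def fun_eq_iff indicator_def abs_less_iff)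
    finally show ?thesis .
  qed
  have "has_bochner_integral lborel d 1"
    using key[of "\<lambda>_. 1 :: real"] g by (simp add: q_def)
  then have "emeasure P UNIV = 1"
    using d by (simp add: P_def emeasure_density has_bochner_integral_iff nn_integral_eq_integral)
  then interpret P: prob_space P
    by (intro prob_spaceI) (simp add: P_def)
  have [measurable]: "X \<in> P \<rightarrow>\<^sub>M borel"
    unfolding P_def by simp
  have N: "real_distribution (distr P borel X)"
    unfolding real_distribution_def real_distribution_axioms_def
    by (auto intro!: P.prob_space_distr)
  show thesis
  proof (rule that[OF N])
    fix f :: "real \<Rightarrow> real"
    assume [measurable]: "f \<in> borel_measurable borel" and f: "integrable lborel (\<lambda>x. g x * f x)"
    have "has_bochner_integral (distr P borel X) f ((\<integral>x. g x * f x \<partial>lborel) + q * f 0)"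
      using key[OF f] d
      by (simp add: has_bochner_integral_iff integrable_distr_eq integral_distr P_def
          integrable_density integral_density)
    then show "has_bochner_integral (distr P borel X) f
        ((\<integral>x. g x * f x \<partial>lborel) + (1 - (\<integral>x. g x \<partial>lborel)) * f 0)"
      by (simp only: q_def)
  qed
qed

section \<open>Infinite divisibility\<close>

text \<open>The law that jumps by \<open>\<plusminus>x\<close> with density \<open>K x / 2\<close> each, and stays at \<open>0\<close> otherwise. By symmetry the
sine part of its characteristic function vanishes, and the atom turns \<open>cos (t * x)\<close> into
\<open>cos (t * x) - 1\<close>.\<close>

lemma exists_symmetric_jump_law:
  fixes K :: "real \<Rightarrow> real"
  assumes K: "set_integrable lborel {0<..} K" "(LBINT x:{0<..}. K x) \<le> 1" "\<And>x. x > 0 \<Longrightarrow> K x \<ge> 0"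
    and a: "a > 0" "\<And>x. 0 < x \<Longrightarrow> x < a \<Longrightarrow> K x = 0"
    and K2: "set_integrable lborel {0<..} (\<lambda>x. x\<^sup>2 * K x)"
  obtains N where "centred_second_moment N (LBINT x:{0<..}. x\<^sup>2 * K x)"
    "\<And>t. char N t = of_real (1 + levy_integral K t)"
proof -
  \<comment> \<open>the value at the origin is set to zero so that the junk value of \<open>K\<close> there does not enter\<close>
  define g where "g x = (if x = 0 then 0 else K \<bar>x\<bar> / 2)" for x
  have half: "indicator {0..} x *\<^sub>R (g x * f x) = indicator {0<..} x *\<^sub>R (f x * K x) / 2" for f :: "real \<Rightarrow> real" and x
    by (auto simp: g_def indicator_def)
  have half_int: "has_bochner_integral lborel (\<lambda>x. indicator {0..} x *\<^sub>R (g x * f x)) ((LBINT x:{0<..}. f x * K x) / 2)"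
    if "set_integrable lborel {0<..} (\<lambda>x. f x * K x)" for f
    unfolding half using that
    by (intro has_bochner_integral_divide_zero)
       (auto simp: has_bochner_integral_iff set_integrable_def set_lebesgue_integral_def)
  have even: "has_bochner_integral lborel (\<lambda>x. g x * f x) (LBINT x:{0<..}. f x * K x)"
    if "set_integrable lborel {0<..} (\<lambda>x. f x * K x)" "\<And>x. f (- x) = f x" for f
    using has_bochner_integral_even_function[OF half_int[OF that(1)]] that(2)
    by (simp add: g_def)
  have odd: "has_bochner_integral lborel (\<lambda>x. g x * f x) 0"
    if "set_integrable lborel {0<..} (\<lambda>x. f x * K x)" "\<And>x. f (- x) = - f x" for f
    using has_bochner_integral_odd_function[OF half_int[OF that(1)]] that(2)
    by (simp add: g_def)
  have Kb: "set_integrable lborel {0<..} (\<lambda>x. f x * K x)"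
    if [measurable]: "f \<in> borel_measurable borel" and f: "\<And>x. \<bar>f x\<bar> \<le> c" for f :: "real \<Rightarrow> real" and c
  proof -
    \<comment> \<open>the factor \<open>x\<^sup>2\<close> is divided out and put back because measurability is known for \<open>x\<^sup>2 * K x\<close>\<close>
    have "set_integrable lborel {0<..} (\<lambda>x. (f x * inverse (x\<^sup>2)) * (x\<^sup>2 * K x))"
      unfolding set_integrable_def
    proof (rule Bochner_Integration.integrable_bound)
      show "integrable lborel (\<lambda>x. c * (indicator {0<..} x *\<^sub>R K x))"
        using K(1) by (auto simp: set_integrable_def)
      note [measurable] = borel_measurable_jump_density[OF K2]
      have "(\<lambda>x. (f x * inverse (x\<^sup>2)) * (x\<^sup>2 * (indicator {0<..} x * K x))) \<in> borel_measurable lborel"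
        by measurable
      then show "(\<lambda>x. indicator {0<..} x *\<^sub>R ((f x * inverse (x\<^sup>2)) * (x\<^sup>2 * K x))) \<in> borel_measurable lborel"
        by (simp add: mult_ac)
      show "AE x in lborel. norm (indicator {0<..} x *\<^sub>R ((f x * inverse (x\<^sup>2)) * (x\<^sup>2 * K x)))
          \<le> norm (c * (indicator {0<..} x *\<^sub>R K x))"
      proof (intro AE_I2)
        fix x
        have "\<bar>f x\<bar> * \<bar>K x\<bar> \<le> \<bar>c\<bar> * \<bar>K x\<bar>"
          using order.trans[OF f abs_ge_self] by (intro mult_right_mono) auto
        then show "norm (indicator {0<..} x *\<^sub>R ((f x * inverse (x\<^sup>2)) * (x\<^sup>2 * K x)))
            \<le> norm (c * (indicator {0<..} x *\<^sub>R K x))"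
          by (auto simp: indicator_def abs_mult field_simps)
      qed
    qed
    then show ?thesis
      by (rule set_integrable_cong[THEN iffD1, rotated -1]) auto
  qed
  have g_tot: "has_bochner_integral lborel g (LBINT x:{0<..}. K x)"
    using even[of "\<lambda>_. 1"] K by simp
  have "integrable lborel g" "\<And>x. g x \<ge> 0" "(\<integral>x. g x \<partial>lborel) \<le> 1"
    "\<And>x. \<bar>x\<bar> < a \<Longrightarrow> g x = 0"
    using g_tot K a(1) by (auto simp: has_bochner_integral_iff) (auto simp: g_def a(2))
  note g = this
  obtain N where N: "real_distribution N"
    and Nr: "\<And>f :: real \<Rightarrow> real. f \<in> borel_measurable borel \<Longrightarrow>
       integrable lborel (\<lambda>x. g x * f x) \<Longrightarrow>
       has_bochner_integral N f ((\<integral>x. g x * f x \<partial>lborel) + (1 - (\<integral>x. g x \<partial>lborel)) * f 0)"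
    using exists_law_with_density_and_atom[OF g(1,2,3) a(1) g(4)] by blast
  have K1: "set_integrable lborel {0<..} (\<lambda>x. x * K x)"
  proof -
    have "set_integrable lborel {0<..} (\<lambda>x. x\<^sup>2 * K x + K x)"
      using K2 K(1) by (rule set_integral_add)
    then show ?thesis
      unfolding set_integrable_def
    proof (rule Bochner_Integration.integrable_bound)
      note [measurable] = borel_measurable_jump_density[OF K2]
      have "(\<lambda>x. x * (indicator {0<..} x * K x)) \<in> borel_measurable lborel"
        by measurable
      then show "(\<lambda>x. indicator {0<..} x *\<^sub>R (x * K x)) \<in> borel_measurable lborel"
        by (simp add: mult_ac)
      have "\<bar>x * K x\<bar> \<le> \<bar>x\<^sup>2 * K x + K x\<bar>" if "x > 0" for x
      proof -
        have "x \<le> x\<^sup>2 + 1" using zero_le_power2[of "x - 1"] that by (simp add: power2_eq_square algebra_simps)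
        then have "x * K x \<le> (x\<^sup>2 + 1) * K x" using K(3)[OF that] by (intro mult_right_mono)
        then show ?thesis using K(3)[OF that] that by (simp add: algebra_simps)
      qed
      then show "AE x in lborel. norm (indicator {0<..} x *\<^sub>R (x * K x))
          \<le> norm (indicator {0<..} x *\<^sub>R (x\<^sup>2 * K x + K x))"
        by (intro AE_I2) (auto simp: indicator_def)
    qed
  qed
  have "centred_second_moment N (LBINT x:{0<..}. x\<^sup>2 * K x)"
    unfolding centred_second_moment_def
    using N Nr[of "\<lambda>x. x"] Nr[of "\<lambda>x. x\<^sup>2"] odd[of "\<lambda>x. x"] even[of "\<lambda>x. x\<^sup>2"] K1 K2
    by (simp add: has_bochner_integral_iff)
  moreover have "char N t = of_real (1 + levy_integral K t)" for t
  proof -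
    define I where "I = (LBINT x:{0<..}. cos (t * x) * K x)"
    have "has_bochner_integral lborel (\<lambda>x. g x * cos (t * x)) I"
      unfolding I_def by (intro even Kb[where c = 1]) auto
    then have c: "has_bochner_integral N (\<lambda>x. cos (t * x)) (1 + (I - (LBINT x:{0<..}. K x)))"
      using Nr[of "\<lambda>x. cos (t * x)"] g_tot by (simp add: has_bochner_integral_iff)
    have "has_bochner_integral lborel (\<lambda>x. g x * sin (t * x)) 0"
      by (intro odd Kb[where c = 1]) auto
    then have s: "has_bochner_integral N (\<lambda>x. sin (t * x)) 0"
      using Nr[of "\<lambda>x. sin (t * x)"] by (simp add: has_bochner_integral_iff)
    have "has_bochner_integral N (\<lambda>x. complex_of_real (cos (t * x)) + \<i> * complex_of_real (sin (t * x)))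
        (complex_of_real (1 + (I - (LBINT x:{0<..}. K x))) + \<i> * complex_of_real 0)"
      by (intro has_bochner_integral_add has_bochner_integral_mult_right has_bochner_integral_of_real c s)
    also have "(\<lambda>x. complex_of_real (cos (t * x)) + \<i> * complex_of_real (sin (t * x)))
        = (\<lambda>x. iexp (t * x))"
      by (auto simp: fun_eq_iff complex_eq_iff Re_exp Im_exp)
    finally have "char N t = of_real (1 + (I - (LBINT x:{0<..}. K x)))"
      by (simp add: char_def has_bochner_integral_iff)
    also have "I - (LBINT x:{0<..}. K x) = (LBINT x:{0<..}. cos (t * x) * K x - K x)"
      unfolding I_def by (intro set_integral_diff(2)[symmetric] K(1) Kb[where c = 1]) auto
    also have "\<dots> = levy_integral K t"
      by (simp add: levy_integral_def algebra_simps)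
    finally show ?thesis .
  qed
  ultimately show thesis by (rule that)
qed

text \<open>Both bounds come from \<open>1 + y \<le> exp y\<close>: used for \<open>y = z m / n m\<close> it is the upper one, and used for
\<open>- (y / (1 + y))\<close> it gives \<open>exp (y / (1 + y)) \<le> 1 + y\<close>.\<close>

lemma tendsto_exp_compound:
  fixes z :: "nat \<Rightarrow> real" and n :: "nat \<Rightarrow> nat"
  assumes z: "z \<longlonglongrightarrow> L" "\<And>m. z m \<le> 0" and n: "filterlim n at_top sequentially"
  shows "(\<lambda>m. (1 + z m / n m) ^ n m) \<longlonglongrightarrow> exp L"
proof (rule tendsto_sandwich)
  have n': "filterlim (\<lambda>m. real (n m)) at_top sequentially"
    using n by (rule filterlim_compose[OF filterlim_real_sequentially])
  have u: "(\<lambda>m. z m / n m) \<longlonglongrightarrow> 0"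
    using z(1) n' by (rule tendsto_divide_0[OF _ filterlim_at_top_imp_at_infinity])
  have ev: "eventually (\<lambda>m. z m / n m > -1) sequentially" "eventually (\<lambda>m. n m > 0) sequentially"
    using order_tendstoD(1)[OF u, of "-1"] filterlim_at_top[THEN iffD1, OF n, rule_format, of 1]
    by (auto elim!: eventually_mono simp: Suc_le_eq)
  show "eventually (\<lambda>m. exp (z m / (1 + z m / n m)) \<le> (1 + z m / n m) ^ n m) sequentially"
    using ev
  proof eventually_elim
    case (elim m)
    define y where "y = z m / n m"
    have y: "y > -1" "z m = n m * y" using elim by (auto simp: y_def)
    have "1 / (1 + y) = 1 + (- (y / (1 + y)))" using y by (simp add: field_simps)
    also have "\<dots> \<le> exp (- (y / (1 + y)))" by (rule exp_ge_add_one_self)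
    finally have "exp (y / (1 + y)) \<le> 1 + y"
      using y by (simp add: exp_minus field_simps)
    then have "exp (y / (1 + y)) ^ n m \<le> (1 + y) ^ n m"
      by (intro power_mono) auto
    then show ?case by (simp add: y exp_of_nat_mult[symmetric] flip: y_def)
  qed
  show "eventually (\<lambda>m. (1 + z m / n m) ^ n m \<le> exp (z m)) sequentially"
    using ev
  proof eventually_elim
    case (elim m)
    have "(1 + z m / n m) ^ n m \<le> exp (z m / n m) ^ n m"
      using elim by (intro power_mono exp_ge_add_one_self) auto
    also have "\<dots> = exp (z m)" using elim by (simp flip: exp_of_nat_mult)
    finally show ?case .
  qed
  show "(\<lambda>m. exp (z m)) \<longlonglongrightarrow> exp L" using z(1) by (rule tendsto_exp)
  have "(\<lambda>m. exp (z m / (1 + z m / n m))) \<longlonglongrightarrow> exp (L / (1 + 0))"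
    by (intro tendsto_intros z u) auto
  then show "(\<lambda>m. exp (z m / (1 + z m / n m))) \<longlonglongrightarrow> exp L" by simp
qed

text \<open>Jumps smaller than \<open>a m = 1 / (m + 1)\<close> are discarded, which leaves a jump measure \<open>J m\<close> of finite
mass. For \<open>n m\<close> above this mass, \<open>J m / n m\<close> is the jump part of a law as constructed above, and
the \<open>n m\<close>-fold convolution power of that law has the characteristic function
\<open>(1 + levy_integral (J m) t / n m) ^ n m\<close>, which tends to \<open>exp (levy_integral k t)\<close>. The second
moments of these powers are the integrals of \<open>x\<^sup>2 * J m x\<close> and so stay below \<open>V\<close>.\<close>

lemma exists_law_with_levy_integral_exponent:
  fixes k :: "real \<Rightarrow> real"
  assumes k: "set_integrable lborel {0<..} (\<lambda>x. x\<^sup>2 * k x)" and nonneg: "\<And>x. x > 0 \<Longrightarrow> k x \<ge> 0"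
  obtains M where "real_distribution M" "\<And>t. char M t = exp (of_real (levy_integral k t))"
proof -
  define V where "V = (LBINT x:{0<..}. x\<^sup>2 * k x)"
  define a where "a m = 1 / real (Suc m)" for m
  \<comment> \<open>large enough for the mass \<open>\<le> (m + 1)\<^sup>2 * V\<close> of \<open>J m\<close>, and, thanks to the summand \<open>1\<close>, also for \<open>n m \<ge> m + 1\<close> if \<open>V = 0\<close>\<close>
  define n where "n m = nat \<lceil>(real (Suc m))\<^sup>2 * (V + 1)\<rceil>" for m
  define J where "J m x = indicator {a m..} x * k x" for m x
  define K where "K m = (\<lambda>x. J m x / real (n m))" for m
  have [measurable]: "(\<lambda>x. indicator {0<..} x * k x) \<in> borel_measurable borel"
    by (rule borel_measurable_jump_density[OF k])
  have V: "V \<ge> 0"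
    unfolding V_def set_lebesgue_integral_def
    by (intro integral_nonneg_AE AE_I2) (auto simp: indicator_def nonneg)
  have a: "a m > 0" for m by (simp add: a_def)
  have n: "real (n m) \<ge> (real (Suc m))\<^sup>2 * (V + 1)" for m
    unfolding n_def by linarith
  have n_pos: "n m > 0" for m
    using n[of m] V by (intro gr0I) (auto simp: add_nonneg_pos mult_le_0_iff)
  have one_le: "1 \<le> (real (Suc m))\<^sup>2 * x\<^sup>2" if "x \<ge> a m" for x m
  proof -
    have "1 \<le> real (Suc m) * x" using that by (simp add: a_def field_simps)
    then have "1 \<le> (real (Suc m) * x)\<^sup>2" by (rule one_le_power)
    then show ?thesis by (simp only: power_mult_distrib)
  qed
  have J2: "set_integrable lborel {0<..} (\<lambda>x. x\<^sup>2 * J m x)" for m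
    unfolding J_def mult.assoc[symmetric] using k
    by (rule set_integrable_jump_bound[where c = 1]) (auto simp: indicator_def)
  have J0: "set_integrable lborel {0<..} (J m)" for m
    unfolding J_def using k
  proof (rule set_integrable_jump_bound)
    show "\<bar>indicator {a m..} x\<bar> \<le> (real (Suc m))\<^sup>2 * x\<^sup>2" for x
      using one_le[of m x] by (auto simp: indicator_def simp del: of_nat_Suc)
  qed simp
  have J0_le: "(LBINT x:{0<..}. J m x) \<le> n m" for m
  proof -
    have "(LBINT x:{0<..}. J m x) \<le> (LBINT x:{0<..}. (real (Suc m))\<^sup>2 * (x\<^sup>2 * k x))"
    proof (rule set_integral_mono)
      fix x :: real assume "x \<in> {0<..}"
      then have "k x \<ge> 0" using nonneg by simp
      then show "J m x \<le> (real (Suc m))\<^sup>2 * (x\<^sup>2 * k x)"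
        using mult_right_mono[OF one_le[of m x], of "k x"]
        by (cases "x \<ge> a m") (auto simp: J_def mult.assoc simp del: of_nat_Suc)
    qed (use J0 k in auto)
    also have "\<dots> = (real (Suc m))\<^sup>2 * V" by (simp add: V_def)
    also have "\<dots> \<le> (real (Suc m))\<^sup>2 * (V + 1)" by (intro mult_left_mono) auto
    also note n
    finally show ?thesis .
  qed
  have J2_le: "(LBINT x:{0<..}. x\<^sup>2 * J m x) \<le> V" for m
    unfolding V_def using J2 k
    by (rule set_integral_mono) (auto simp: J_def indicator_def nonneg)
  have J_lim: "(\<lambda>m. levy_integral (J m) t) \<longlonglongrightarrow> levy_integral k t" for t
    unfolding levy_integral_def set_lebesgue_integral_def
  proof (rule integral_dominated_convergence)
    let ?f = "\<lambda>x. indicator {0<..} x *\<^sub>R ((cos (t * x) - 1) * k x)"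
    show "integrable lborel (\<lambda>x. norm (?f x))"
      using set_integrable_levy[OF k, of t] by (simp add: set_integrable_def)
    have "(\<lambda>x. (cos (t * x) - 1) * (indicator {0<..} x * k x)) \<in> borel_measurable lborel"
      by measurable
    then show meas: "?f \<in> borel_measurable lborel" by (simp add: mult_ac)
    show "(\<lambda>x. indicator {0<..} x *\<^sub>R ((cos (t * x) - 1) * J m x)) \<in> borel_measurable lborel" for m
    proof -
      have "(\<lambda>x. indicator {a m..} x * ?f x) \<in> borel_measurable lborel"
        using meas by (intro borel_measurable_times) auto
      then show ?thesis by (simp add: J_def mult_ac)
    qed
    show "AE x in lborel. norm (indicator {0<..} x *\<^sub>R ((cos (t * x) - 1) * J m x)) \<le> norm (?f x)" for m
      by (intro AE_I2) (auto simp: J_def indicator_def)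
    show "AE x in lborel. (\<lambda>m. indicator {0<..} x *\<^sub>R ((cos (t * x) - 1) * J m x)) \<longlonglongrightarrow> ?f x"
    proof (intro AE_I2)
      fix x :: real
      show "(\<lambda>m. indicator {0<..} x *\<^sub>R ((cos (t * x) - 1) * J m x)) \<longlonglongrightarrow> ?f x"
      proof (cases "x > 0")
        case True
        have "a \<longlonglongrightarrow> 0" unfolding a_def by (rule LIMSEQ_Suc[OF lim_1_over_n])
        then have "eventually (\<lambda>m. a m < x) sequentially" using True by (rule order_tendstoD)
        then have "eventually (\<lambda>m. ?f x = indicator {0<..} x *\<^sub>R ((cos (t * x) - 1) * J m x)) sequentially"
          by eventually_elim (simp add: J_def)
        then show ?thesis by (rule Lim_transform_eventually[OF tendsto_const])
      qed simp
    qed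
  qed
  have J_nonpos: "levy_integral (J m) t \<le> 0" for m t
  proof -
    have "0 \<le> (LBINT x:{0<..}. - ((cos (t * x) - 1) * J m x))"
      unfolding set_lebesgue_integral_def using nonneg
      by (intro integral_nonneg_AE AE_I2)
         (auto simp: indicator_def J_def mult_nonpos_nonneg)
    also have "\<dots> = - levy_integral (J m) t"
      unfolding levy_integral_def by (simp add: set_lebesgue_integral_def)
    finally show ?thesis by simp
  qed
  have "\<exists>N. centred_second_moment N ((LBINT x:{0<..}. x\<^sup>2 * J m x) / n m) \<and>
      (\<forall>t. char N t = of_real (1 + levy_integral (J m) t / n m))" for m
  proof -
    have "set_integrable lborel {0<..} (K m)" "(LBINT x:{0<..}. K m x) \<le> 1"
      "set_integrable lborel {0<..} (\<lambda>x. x\<^sup>2 * K m x)"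
      using J0[of m] J2[of m] J0_le[of m] n_pos[of m] by (simp_all add: K_def)
    moreover have "\<And>x. x > 0 \<Longrightarrow> K m x \<ge> 0" "\<And>x. 0 < x \<Longrightarrow> x < a m \<Longrightarrow> K m x = 0"
      using nonneg by (auto simp: K_def J_def indicator_def)
    ultimately obtain N where "centred_second_moment N (LBINT x:{0<..}. x\<^sup>2 * K m x)"
        "\<And>t. char N t = of_real (1 + levy_integral (K m) t)"
      using exists_symmetric_jump_law[of "K m" "a m"] a[of m] by metis
    then show ?thesis
      by (auto simp: K_def levy_integral_def)
  qed
  then obtain N where N: "\<And>m. centred_second_moment (N m) ((LBINT x:{0<..}. x\<^sup>2 * J m x) / n m)"
    and char_N: "\<And>m t. char (N m) t = of_real (1 + levy_integral (J m) t / n m)"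
    by metis
  have moments: "centred_second_moment (conv_pow (N m) (n m)) (LBINT x:{0<..}. x\<^sup>2 * J m x)" for m
    using centred_second_moment_conv_pow[OF N, of m "n m"] n_pos[of m] by simp
  have lim: "(\<lambda>m. char (conv_pow (N m) (n m)) t) \<longlonglongrightarrow> exp (of_real (levy_integral k t))" for t
  proof -
    have n_lim: "filterlim n at_top sequentially"
    proof (rule filterlim_at_top_mono[OF filterlim_Suc])
      have "real (Suc m) \<le> n m" for m
      proof -
        have "real (Suc m) * 1 \<le> (real (Suc m) * real (Suc m)) * (V + 1)"
          using V by (intro mult_mono) auto
        also have "\<dots> \<le> n m" using n[of m] by (simp only: power2_eq_square)
        finally show ?thesis by simp
      qed
      then have "Suc m \<le> n m" for m by (simp only: of_nat_le_iff)
      then show "eventually (\<lambda>m. Suc m \<le> n m) sequentially" by (intro always_eventually) simp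
    qed
    have "(\<lambda>m. (1 + levy_integral (J m) t / n m) ^ n m) \<longlonglongrightarrow> exp (levy_integral k t)"
      by (rule tendsto_exp_compound[OF J_lim J_nonpos n_lim])
    then have "(\<lambda>m. complex_of_real ((1 + levy_integral (J m) t / n m) ^ n m)) \<longlonglongrightarrow> of_real (exp (levy_integral k t))"
      by (rule tendsto_of_real)
    moreover have "char (conv_pow (N m) (n m)) t = of_real ((1 + levy_integral (J m) t / n m) ^ n m)" for m
      using N[of m] by (subst char_conv_pow) (auto simp: centred_second_moment_def char_N)
    ultimately show ?thesis by (simp add: exp_of_real)
  qed
  show thesis
    by (rule char_limit_of_bounded_second_moments[OF moments J2_le lim]) (rule that; blast)
qed

text \<open>The \<open>n\<close>-th convolution root of the law with jump density \<open>k\<close> is the law with jump density \<open>k / n\<close>: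
both sides have the same characteristic function, so the uniqueness theorem applies.\<close>

theorem levy_exponent_levy_integral:
  fixes k :: "real \<Rightarrow> real"
  assumes k: "set_integrable lborel {0<..} (\<lambda>x. x\<^sup>2 * k x)" and nonneg: "\<And>x. x > 0 \<Longrightarrow> k x \<ge> 0"
  shows "levy_exponent (\<lambda>t. of_real (levy_integral k t))"
proof -
  obtain M where M: "real_distribution M" "\<And>t. char M t = exp (of_real (levy_integral k t))"
    by (rule exists_law_with_levy_integral_exponent[OF assms]) blast+
  have "\<exists>N. real_distribution N \<and> M = conv_pow N n" if "n \<ge> 1" for n
  proof -
    have "set_integrable lborel {0<..} (\<lambda>x. x\<^sup>2 * (k x / n))"
      using k by simp
    then obtain N where N: "real_distribution N"
        "\<And>t. char N t = exp (of_real (levy_integral (\<lambda>x. k x / n) t))"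
      by (rule exists_law_with_levy_integral_exponent) (use nonneg in auto)
    have "char (conv_pow N n) t = char M t" for t
    proof -
      have "char (conv_pow N n) t = exp (of_nat n * of_real (levy_integral k t / n))"
        by (simp add: char_conv_pow N exp_of_nat_mult levy_integral_def flip: of_real_divide)
      then show ?thesis using that by (simp add: M)
    qed
    then have "M = conv_pow N n"
      using M(1) N(1) by (intro Levy_uniqueness real_distribution_conv_pow) auto
    with N(1) show ?thesis by blast
  qed
  then have "infinitely_divisible M"
    using M(1) by (simp add: infinitely_divisible_def)
  moreover have "continuous_on UNIV (levy_integral k)"
    using has_real_derivative_levy_integral[OF k]
    by (intro continuous_at_imp_continuous_on ballI) (blast intro: DERIV_isCont)
  ultimately show ?thesis
    using M(2) by (auto simp: levy_exponent_def levy_integral_def[of _ 0] intro!: continuous_intros)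
qed

section \<open>Partial fractions and the first identity\<close>

text \<open>The logarithmic derivative of \<open>Gamma z * Gamma (1 - z) = pi / sin (pi * z)\<close>.\<close>

lemma Digamma_reflection:
  fixes z :: complex
  assumes z: "z \<notin> \<int>"
  shows "Digamma (1 - z) - Digamma z = of_real pi * cos (of_real pi * z) / sin (of_real pi * z)"
proof -
  let ?p = "complex_of_real pi"
  have s: "sin (?p * z) \<noteq> 0"
    using z by (auto simp: sin_eq_0 mult_ac)
  have "1 - z \<notin> \<int>" using z by (metis Ints_1 Ints_diff diff_diff_eq2 add_diff_cancel_left')
  then have nz: "z \<notin> \<int>\<^sub>\<le>\<^sub>0" "1 - z \<notin> \<int>\<^sub>\<le>\<^sub>0"
    using z by (auto dest: nonpos_Ints_Int)
  have "((\<lambda>w. Gamma w * Gamma (1 - w)) has_field_derivative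
      Gamma z * Gamma (1 - z) * (Digamma z - Digamma (1 - z))) (at z)"
    using nz by (auto intro!: derivative_eq_intros simp: algebra_simps)
  moreover have "((\<lambda>w. Gamma w * Gamma (1 - w)) has_field_derivative
      - (?p * ?p * cos (?p * z) / (sin (?p * z))\<^sup>2)) (at z)"
    unfolding Gamma_reflection_complex using s
    by (auto intro!: derivative_eq_intros simp: power2_eq_square)
  ultimately have "Gamma z * Gamma (1 - z) * (Digamma z - Digamma (1 - z)) =
      - (?p * ?p * cos (?p * z) / (sin (?p * z))\<^sup>2)"
    by (rule DERIV_unique)
  then have *: "?p / sin (?p * z) * (Digamma z - Digamma (1 - z)) =
      - (?p * ?p * cos (?p * z) / (sin (?p * z))\<^sup>2)"
    by (simp only: Gamma_reflection_complex)
  have "Digamma z - Digamma (1 - z) =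
      sin (?p * z) / ?p * (?p / sin (?p * z) * (Digamma z - Digamma (1 - z)))"
    using s by simp
  also have "\<dots> = - (?p * cos (?p * z) / sin (?p * z))"
    unfolding * using s by (simp add: power2_eq_square)
  finally show ?thesis by (simp add: algebra_simps)
qed

text \<open>The partial fractions of the cotangent on the imaginary axis. The terms of the series of
\<open>Digamma (1 + z)\<close> exceed those of \<open>Digamma (1 - z)\<close> by \<open>2 * z / ((n + 1)\<^sup>2 - z\<^sup>2)\<close>, which at
\<open>z = \<i> * t / pi\<close> becomes real when multiplied by \<open>z\<close>.\<close>

lemma coth_partial_fractions:
  assumes t: "t \<noteq> 0"
  shows "(\<lambda>n. 2 * t\<^sup>2 / (t\<^sup>2 + (pi * real (Suc n))\<^sup>2)) sums (t * coth t - 1)"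
proof -
  define z where "z = \<i> * complex_of_real (t / pi)"
  have z: "z \<notin> \<int>"
  proof
    assume "z \<in> \<int>"
    then have "Im z = 0" by (auto elim: Ints_cases)
    then show False using t by (simp add: z_def)
  qed
  then have z0: "z \<noteq> 0" by auto
  have pz: "of_real pi * z = \<i> * of_real t" by (simp add: z_def)
  have zp: "1 + z \<noteq> 0" "1 - z \<noteq> 0"
    using z by (metis Ints_1 Ints_minus add_eq_0_iff, auto)
  have nz: "of_nat (Suc n) + z \<noteq> 0" "of_nat (Suc n) - z \<noteq> 0" for n
    using z by (metis Ints_minus Ints_of_nat add_eq_0_iff, metis Ints_of_nat eq_iff_diff_eq_0)
  have "(\<lambda>n. inverse (of_nat (Suc n)) - inverse (w + of_nat n)) sums (Digamma w + euler_mascheroni)"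
    if "w \<noteq> 0" for w :: complex
    using summable_sums[OF summable_Digamma[OF that]] by (simp add: Digamma_def)
  from sums_diff[OF this[OF zp(2)] this[OF zp(1)]]
  have "(\<lambda>n. inverse (1 + z + of_nat n) - inverse (1 - z + of_nat n)) sums (Digamma (1 - z) - Digamma (1 + z))"
    by simp
  moreover have "Digamma (1 - z) - Digamma (1 + z) =
      of_real pi * cos (of_real pi * z) / sin (of_real pi * z) - 1 / z"
    using Digamma_plus1[OF z0] Digamma_reflection[OF z] by (simp add: add.commute)
  ultimately have "(\<lambda>n. z * (inverse (1 + z + of_nat n) - inverse (1 - z + of_nat n)))
      sums (z * (of_real pi * cos (of_real pi * z) / sin (of_real pi * z) - 1 / z))"
    by (metis sums_mult)
  also have "z * (of_real pi * cos (of_real pi * z) / sin (of_real pi * z) - 1 / z) =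
      (of_real pi * z) * cos (of_real pi * z) / sin (of_real pi * z) - 1"
    using z0 by (simp add: right_diff_distrib mult_ac)
  also have "\<dots> = of_real (t * coth t - 1)"
  proof -
    have "cos (\<i> * of_real t) = cosh (complex_of_real t)"
      "sin (\<i> * of_real t) = \<i> * sinh (complex_of_real t)"
      by (simp_all add: cosh_conv_cos sinh_conv_sin)
    moreover have "cosh (complex_of_real t) = of_real (cosh t)" "sinh (complex_of_real t) = of_real (sinh t)"
      by (simp_all add: cosh_def sinh_def scaleR_conv_of_real exp_of_real exp_minus)
    ultimately have "cos (\<i> * of_real t) = of_real (cosh t)" "sin (\<i> * of_real t) = \<i> * of_real (sinh t)"
      by simp_all
    then show ?thesis by (simp add: pz coth_def)
  qed
  also have "(\<lambda>n. z * (inverse (1 + z + of_nat n) - inverse (1 - z + of_nat n))) =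
      (\<lambda>n. complex_of_real (2 * t\<^sup>2 / (t\<^sup>2 + (pi * real (Suc n))\<^sup>2)))"
  proof
    fix n
    let ?N = "of_nat (Suc n) :: complex"
    have "(\<i> * complex_of_real u) * (\<i> * complex_of_real u) = - of_real (u\<^sup>2)" for u
      by (simp add: complex_eq_iff power2_eq_square)
    from this[of "t / pi"] have zz: "z * z = - of_real ((t / pi)\<^sup>2)" by (simp only: z_def)
    have "z * (inverse (1 + z + of_nat n) - inverse (1 - z + of_nat n)) =
        z * (inverse (?N + z) - inverse (?N - z))"
      by (simp add: algebra_simps)
    also have "\<dots> = - 2 * (z * z) / ((?N + z) * (?N - z))"
      using nz[of n] by (simp add: divide_simps del: of_nat_Suc)
    also have "(?N + z) * (?N - z) = ?N * ?N - z * z"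
      by (simp add: algebra_simps del: of_nat_Suc)
    also have "- 2 * (z * z) / (?N * ?N - z * z) = of_real (2 * (t / pi)\<^sup>2 / ((real (Suc n))\<^sup>2 + (t / pi)\<^sup>2))"
      unfolding zz by (simp add: power2_eq_square del: of_nat_Suc)
    also have "2 * (t / pi)\<^sup>2 / ((real (Suc n))\<^sup>2 + (t / pi)\<^sup>2) = 2 * t\<^sup>2 / (t\<^sup>2 + (pi * real (Suc n))\<^sup>2)"
      by (simp add: power_divide power_mult_distrib divide_simps del: of_nat_Suc) (simp add: algebra_simps)
    finally show "z * (inverse (1 + z + of_nat n) - inverse (1 - z + of_nat n)) =
        complex_of_real (2 * t\<^sup>2 / (t\<^sup>2 + (pi * real (Suc n))\<^sup>2))" .
  qed
  finally show ?thesis by (simp only: sums_of_real_iff)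
qed

text \<open>With \<open>q = exp (- 2 * y)\<close> one has \<open>(csch y)\<^sup>2 = 4 * q / (1 - q)\<^sup>2\<close>, and \<open>1 / (1 - q)\<^sup>2\<close> is the differentiated
geometric series.\<close>

lemma csch_square_sums:
  assumes "y > 0"
  shows "(\<lambda>n. 4 * (real (Suc n) * exp (- (2 * y * real (Suc n))))) sums (csch y)\<^sup>2"
proof -
  define q where "q = exp (- (2 * y))"
  have q: "0 < q" "q < 1" using assms by (auto simp: q_def)
  have qp: "exp (- (2 * y * real (Suc n))) = q * q ^ n" for n
  proof -
    have "- (2 * y * real (Suc n)) = - (2 * y) + real n * - (2 * y)"
      by (simp add: algebra_simps)
    then show ?thesis by (simp only: exp_add exp_of_nat_mult q_def)
  qed
  have "(\<lambda>n. of_nat (Suc n) * q ^ n) sums (1 / (1 - q)\<^sup>2)"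
    using q by (intro geometric_deriv_sums) auto
  from sums_mult[OF this, of "4 * q"]
  have "(\<lambda>n. 4 * (real (Suc n) * exp (- (2 * y * real (Suc n))))) sums (4 * q / (1 - q)\<^sup>2)"
    unfolding qp by (simp add: mult_ac del: of_nat_Suc)
  also have "4 * q / (1 - q)\<^sup>2 = (csch y)\<^sup>2"
  proof -
    define r where "r = exp (- y)"
    have r: "0 < r" "r < 1" using assms by (auto simp: r_def)
    have "q = r * r" by (simp add: q_def r_def flip: exp_add)
    moreover have "sinh y = (1 - r * r) / (2 * r)"
      using r by (simp add: sinh_field_def r_def exp_minus field_simps)
    moreover have "1 - r * r \<noteq> 0" using r mult_strict_mono[of r 1 r 1] by auto
    ultimately show ?thesis
      by (simp add: csch_def power_divide power2_eq_square)
  qed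
  finally show ?thesis .
qed

lemma laplace_one_minus_cos:
  fixes a t :: real
  assumes a: "a > 0"
  shows "set_integrable lborel {0<..} (\<lambda>x. (1 - cos (t * x)) * exp (- (a * x)))"
    and "(LBINT x:{0<..}. (1 - cos (t * x)) * exp (- (a * x))) = t\<^sup>2 / (a * (a\<^sup>2 + t\<^sup>2))"
proof -
  define c where "c = 1 / (a\<^sup>2 + t\<^sup>2)"
  \<comment> \<open>the antiderivative that vanishes at infinity\<close>
  define F where "F x = exp (- (a * x)) * ((a * cos (t * x) - t * sin (t * x)) * c - 1 / a)" for x
  have pos: "a\<^sup>2 + t\<^sup>2 > 0" using a by (intro add_pos_nonneg) auto
  note FTC = interval_integral_FTC_nonneg[where a = 0 and b = \<infinity> and F = F
    and f = "\<lambda>x. (1 - cos (t * x)) * exp (- (a * x))" and A = "F 0" and B = 0]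
  have D: "DERIV F x :> (1 - cos (t * x)) * exp (- (a * x))" for x
  proof -
    let ?p = "- (a * (t * sin (t * x))) - t * (t * cos (t * x))"
    let ?q = "a * cos (t * x) - t * sin (t * x)"
    have "DERIV F x :> exp (- (a * x)) * (?p * c) - a * exp (- (a * x)) * (?q * c - 1 / a)"
      unfolding F_def by (rule derivative_eq_intros refl)+ (simp add: algebra_simps)
    also have "exp (- (a * x)) * (?p * c) - a * exp (- (a * x)) * (?q * c - 1 / a) =
        exp (- (a * x)) * ((?p - a * ?q) * c + 1)"
      using a by (simp add: algebra_simps)
    also have "?p - a * ?q = - cos (t * x) * (a\<^sup>2 + t\<^sup>2)"
      by (simp add: power2_eq_square algebra_simps)
    also have "(- cos (t * x) * (a\<^sup>2 + t\<^sup>2)) * c = - cos (t * x)"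
      using pos a by (simp add: c_def)
    finally show ?thesis by (simp add: algebra_simps)
  qed
  have cont: "isCont F x" for x using D by (rule DERIV_isCont)
  have lim0: "((F \<circ> real_of_ereal) \<longlongrightarrow> F 0) (at_right 0)"
  proof -
    have "(F \<longlongrightarrow> F 0) (at_right 0)"
      using cont[of 0] by (auto simp: isCont_def intro: tendsto_within_subset)
    then show ?thesis by (simp add: zero_ereal_def ereal_tendsto_simps)
  qed
  have liminf: "((F \<circ> real_of_ereal) \<longlongrightarrow> 0) (at_left \<infinity>)"
  proof -
    let ?B = "(a + \<bar>t\<bar>) * c + 1 / a"
    have "(F \<longlongrightarrow> 0) at_top"
    proof (rule Lim_null_comparison)
      show "eventually (\<lambda>x. norm (F x) \<le> exp (- (a * x)) * ?B) at_top"
      proof (intro always_eventually allI)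
        fix x
        have "\<bar>a * cos (t * x) - t * sin (t * x)\<bar> \<le> \<bar>a * cos (t * x)\<bar> + \<bar>t * sin (t * x)\<bar>"
          by (rule abs_triangle_ineq4)
        also have "\<dots> \<le> a * 1 + \<bar>t\<bar> * 1"
          unfolding abs_mult using a by (intro add_mono mult_mono) auto
        finally have "\<bar>(a * cos (t * x) - t * sin (t * x)) * c\<bar> \<le> (a + \<bar>t\<bar>) * c"
          using pos by (simp add: abs_mult c_def divide_right_mono)
        then have "\<bar>(a * cos (t * x) - t * sin (t * x)) * c - 1 / a\<bar> \<le> ?B"
          using a by (intro order.trans[OF abs_triangle_ineq4] add_mono) auto
        then show "norm (F x) \<le> exp (- (a * x)) * ?B"
          unfolding F_def by (simp add: abs_mult)
      qed
      show "((\<lambda>x. exp (- (a * x)) * ?B) \<longlongrightarrow> 0) at_top"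
        using a by real_asymp
    qed
    then show ?thesis by (simp add: ereal_tendsto_simps)
  qed
  have nonneg: "0 \<le> (1 - cos (t * x)) * exp (- (a * x))" for x by simp
  have eint: "einterval 0 \<infinity> = {0<..}" by (auto simp: einterval_def)
  from FTC(1) D lim0 liminf nonneg eint
  show "set_integrable lborel {0<..} (\<lambda>x. (1 - cos (t * x)) * exp (- (a * x)))"
    by (simp add: continuous_intros)
  have "(LBINT x=0..\<infinity>. (1 - cos (t * x)) * exp (- (a * x))) = 0 - F 0"
    using FTC(2) D lim0 liminf nonneg by (simp add: continuous_intros)
  then have "(LBINT x:{0<..}. (1 - cos (t * x)) * exp (- (a * x))) = - F 0"
    by (simp add: interval_lebesgue_integral_def eint)
  also have "- F 0 = t\<^sup>2 / (a * (a\<^sup>2 + t\<^sup>2))"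
    using a pos by (simp add: F_def c_def divide_simps) (simp add: power2_eq_square)
  finally show "(LBINT x:{0<..}. (1 - cos (t * x)) * exp (- (a * x))) = t\<^sup>2 / (a * (a\<^sup>2 + t\<^sup>2))" .
qed

text \<open>Expanding the density into exponentials and integrating term by term gives the partial fractions
of \<open>t * coth t - 1\<close>. The interchange is unproblematic because all terms are nonnegative.\<close>

lemma levy_integral_csch_square:
  assumes t: "t \<noteq> 0"
  shows "levy_integral (\<lambda>x. pi / 2 * (csch (pi * x / 2))\<^sup>2) t = 1 - t * coth t"
proof -
  define a where "a n = pi * real (Suc n)" for n
  have a: "a n > 0" for n by (simp add: a_def)
  define f where "f n x = indicator {0<..} x *\<^sub>R (2 * a n * ((1 - cos (t * x)) * exp (- (a n * x))))" for n x
  have f_nonneg: "f n x \<ge> 0" for n x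
    using a[of n] by (auto simp: f_def indicator_def)
  have f_int: "integrable lborel (f n)" for n
    unfolding f_def set_integrable_def[symmetric] using laplace_one_minus_cos(1)[OF a] by simp
  have f_val: "(\<integral>x. f n x \<partial>lborel) = 2 * t\<^sup>2 / (t\<^sup>2 + (pi * real (Suc n))\<^sup>2)" for n
  proof -
    have "(\<integral>x. f n x \<partial>lborel) = 2 * a n * (t\<^sup>2 / (a n * ((a n)\<^sup>2 + t\<^sup>2)))"
      unfolding f_def set_lebesgue_integral_def[symmetric] using laplace_one_minus_cos(2)[OF a] by simp
    then show ?thesis using a[of n] unfolding a_def[symmetric] by (simp add: add.commute)
  qed
  have f_sums: "(\<lambda>n. f n x) sums - (indicator {0<..} x *\<^sub>R ((cos (t * x) - 1) * (pi / 2 * (csch (pi * x / 2))\<^sup>2)))" for x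
  proof (cases "x > 0")
    case True
    then have "pi * x / 2 > 0" by simp
    from sums_mult[OF csch_square_sums[OF this], of "(1 - cos (t * x)) * (pi / 2)"]
    have "(\<lambda>n. f n x) sums ((1 - cos (t * x)) * (pi / 2) * (csch (pi * x / 2))\<^sup>2)"
      using True by (simp add: f_def a_def mult_ac del: of_nat_Suc)
    then show ?thesis using True by (simp add: algebra_simps diff_divide_distrib)
  qed (simp add: f_def)
  have "(\<lambda>n. \<integral>x. f n x \<partial>lborel) sums (\<integral>x. (\<Sum>n. f n x) \<partial>lborel)"
  proof (rule sums_integral)
    show "AE x in lborel. summable (\<lambda>n. norm (f n x))"
      using f_nonneg sums_summable[OF f_sums] by simp
    show "summable (\<lambda>n. \<integral>x. norm (f n x) \<partial>lborel)"
      using f_nonneg sums_summable[OF coth_partial_fractions[OF t]] by (simp add: f_val del: of_nat_Suc)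
  qed (rule f_int)
  also have "(\<integral>x. (\<Sum>n. f n x) \<partial>lborel) = - levy_integral (\<lambda>x. pi / 2 * (csch (pi * x / 2))\<^sup>2) t"
    using f_sums by (simp add: sums_iff levy_integral_def set_lebesgue_integral_def)
  finally have "(\<lambda>n. 2 * t\<^sup>2 / (t\<^sup>2 + (pi * real (Suc n))\<^sup>2)) sums
      - levy_integral (\<lambda>x. pi / 2 * (csch (pi * x / 2))\<^sup>2) t"
    by (simp only: f_val)
  from sums_unique2[OF coth_partial_fractions[OF t] this] show ?thesis
    by linarith
qed

section \<open>Hyperbolic inequalities\<close>

lemma nonneg_of_deriv_nonneg:
  fixes f f' :: "real \<Rightarrow> real"
  assumes "\<And>x. x \<ge> 0 \<Longrightarrow> (f has_real_derivative f' x) (at x)" "\<And>x. x \<ge> 0 \<Longrightarrow> f' x \<ge> 0"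
    and "f 0 = 0" "y \<ge> 0"
  shows "f y \<ge> 0"
proof -
  have "f 0 \<le> f y"
    using assms by (intro DERIV_nonneg_imp_nondecreasing[of 0 y f]) auto
  then show ?thesis using assms(3) by simp
qed

lemma le_sinh:
  fixes y :: real
  assumes "y \<ge> 0"
  shows "y \<le> sinh y"
proof -
  have "0 \<le> sinh y - y"
    by (rule nonneg_of_deriv_nonneg[where f' = "\<lambda>x. cosh x - 1"])
       (use assms in \<open>auto intro!: derivative_eq_intros cosh_real_ge_1\<close>)
  then show ?thesis by simp
qed

lemma sinh_le_mult_cosh:
  fixes y :: real
  assumes "y \<ge> 0"
  shows "sinh y \<le> y * cosh y"
proof -
  have "0 \<le> y * cosh y - sinh y"
    by (rule nonneg_of_deriv_nonneg[where f' = "\<lambda>x. x * sinh x"])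
       (use assms in \<open>auto intro!: derivative_eq_intros\<close>)
  then show ?thesis by simp
qed

text \<open>The inequality is \<open>1 - y\<^sup>2 / 6 \<le> y / sinh y\<close> with denominators cleared. Two differentiations of the
difference of the two sides lead to a sum of nonnegative terms.\<close>

lemma sinh_mult_le:
  fixes y :: real
  assumes "y \<ge> 0"
  shows "(6 - y\<^sup>2) * sinh y \<le> 6 * y"
proof -
  have *: "0 \<le> 6 + 2 * x * sinh x - (6 - x\<^sup>2) * cosh x" if "x \<ge> 0" for x :: real
  proof (rule nonneg_of_deriv_nonneg[where y = x
        and f = "\<lambda>x. 6 + 2 * x * sinh x - (6 - x\<^sup>2) * cosh x"
        and f' = "\<lambda>x. 4 * (x * cosh x - sinh x) + x\<^sup>2 * sinh x"])
    show "((\<lambda>x. 6 + 2 * x * sinh x - (6 - x\<^sup>2) * cosh x) has_real_derivative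
        4 * (x * cosh x - sinh x) + x\<^sup>2 * sinh x) (at x)" for x :: real
      by (auto intro!: derivative_eq_intros simp: algebra_simps)
    show "0 \<le> 4 * (x * cosh x - sinh x) + x\<^sup>2 * sinh x" if "x \<ge> 0" for x :: real
      using sinh_le_mult_cosh[OF that] that by simp
  qed (use that in auto)
  have "0 \<le> 6 * y - (6 - y\<^sup>2) * sinh y"
    by (rule nonneg_of_deriv_nonneg[where f' = "\<lambda>x. 6 + 2 * x * sinh x - (6 - x\<^sup>2) * cosh x"])
       (use assms * in \<open>auto intro!: derivative_eq_intros simp: algebra_simps\<close>)
  then show ?thesis by simp
qed

lemma csch_pos: "y > 0 \<Longrightarrow> csch y > 0"
  by (simp add: csch_def)

lemma coth_square: "y \<noteq> 0 \<Longrightarrow> (coth y)\<^sup>2 = 1 + (csch y)\<^sup>2"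
  by (simp add: coth_def csch_def power_divide cosh_square_eq add_divide_distrib)

lemma mult_csch_le:
  assumes "y > 0"
  shows "y * csch y \<le> 2 * exp (- (y / 2))"
proof -
  have "y * exp (y / 2) / 2 \<le> 2 * (y / 2) * cosh (y / 2)"
    using assms by (simp add: cosh_field_def)
  also have "\<dots> \<le> 2 * sinh (y / 2) * cosh (y / 2)"
    using le_sinh[of "y / 2"] assms by (intro mult_right_mono) auto
  also have "\<dots> = sinh y"
    using sinh_double[of "y / 2"] by simp
  finally have "y * exp (y / 2) / 2 \<le> sinh y" .
  then show ?thesis
    using assms by (simp add: csch_def exp_minus field_simps)
qed

lemma one_le_mult_coth: "y > 0 \<Longrightarrow> 1 \<le> y * coth y"
  using sinh_le_mult_cosh[of y] by (simp add: coth_def field_simps)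

lemma mult_coth_le:
  assumes "y > 0"
  shows "y * coth y \<le> 1 + y"
proof -
  have "y * (cosh y - sinh y) = y * exp (- y)"
    by (simp add: cosh_field_def sinh_field_def field_simps)
  also have "\<dots> \<le> y * 1" using assms by (intro mult_left_mono) auto
  also have "\<dots> \<le> sinh y" using le_sinh[of y] assms by simp
  finally show ?thesis using assms by (simp add: coth_def field_simps)
qed

text \<open>This is the square of \<open>1 - y\<^sup>2 / 6 \<le> y * csch y\<close>, as long as the left-hand side of the latter is
nonnegative; beyond that point the claim is trivial because its own left-hand side is negative.\<close>

lemma mult_csch_square_ge:
  assumes "y > 0"
  shows "1 - y\<^sup>2 / 3 \<le> (y * csch y)\<^sup>2"
proof (cases "y\<^sup>2 \<le> 6")
  case True
  have "1 - y\<^sup>2 / 6 \<le> y * csch y"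
    using sinh_mult_le[of y] assms by (simp add: csch_def field_simps)
  then have "(1 - y\<^sup>2 / 6)\<^sup>2 \<le> (y * csch y)\<^sup>2"
    using True by (intro power_mono) auto
  moreover have "(1 - y\<^sup>2 / 6)\<^sup>2 = 1 - y\<^sup>2 / 3 + (y\<^sup>2 / 6)\<^sup>2"
    by (simp add: power2_diff)
  moreover have "(y\<^sup>2 / 6)\<^sup>2 \<ge> 0" by simp
  ultimately show ?thesis by linarith
next
  case False
  moreover have "(y * csch y)\<^sup>2 \<ge> 0" by simp
  ultimately show ?thesis by linarith
qed


section \<open>The three jump densities\<close>

definition csch_density1 :: "real \<Rightarrow> real" where
  "csch_density1 x = pi / 2 * (csch (pi * x / 2))\<^sup>2"

definition csch_density2 :: "real \<Rightarrow> real" where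
  "csch_density2 x = pi / 2 * (csch (pi * x / 2))\<^sup>2 * (pi * x * coth (pi * x / 2) - 1)"

definition csch_density3 :: "real \<Rightarrow> real" where
  "csch_density3 x = pi / 4 * (csch (pi * x / 2))\<^sup>2 *
     (2 * pi\<^sup>2 * x\<^sup>2 * (coth (pi * x / 2))\<^sup>2 + pi\<^sup>2 * x\<^sup>2 * (csch (pi * x / 2))\<^sup>2
      - 6 * pi * x * coth (pi * x / 2) + 2)"

lemmas csch_density_defs = csch_density1_def csch_density2_def csch_density3_def

text \<open>In terms of \<open>s = y * csch y\<close> and \<open>c = y * coth y\<close>, which are bounded near \<open>0\<close>, the densities are a double
pole times a polynomial in \<open>s\<close> and \<open>c\<close>. Positivity and decay are both read off from this form.\<close>

lemma csch_density_normal_forms: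
  fixes x :: real
  assumes x: "x > 0"
  defines "y \<equiv> pi * x / 2"
  defines "s \<equiv> y * csch y" and "c \<equiv> y * coth y"
  shows "x\<^sup>2 * csch_density1 x = 2 / pi * s\<^sup>2"
    and "x\<^sup>2 * csch_density2 x = 2 / pi * s\<^sup>2 * (2 * c - 1)"
    and "x\<^sup>2 * csch_density3 x = 1 / pi * s\<^sup>2 * (8 * c\<^sup>2 + 4 * s\<^sup>2 - 12 * c + 2)"
proof -
  have xy: "x = 2 * y / pi" by (simp add: y_def)
  have y: "pi * x / 2 = y" by (simp add: y_def)
  show "x\<^sup>2 * csch_density1 x = 2 / pi * s\<^sup>2"
    unfolding csch_density_defs s_def y by (simp add: xy power2_eq_square field_simps)
  show "x\<^sup>2 * csch_density2 x = 2 / pi * s\<^sup>2 * (2 * c - 1)"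
    unfolding csch_density_defs s_def c_def y by (simp add: xy power2_eq_square)
  show "x\<^sup>2 * csch_density3 x = 1 / pi * s\<^sup>2 * (8 * c\<^sup>2 + 4 * s\<^sup>2 - 12 * c + 2)"
    unfolding csch_density_defs s_def c_def y by (simp add: xy power2_eq_square)
qed

text \<open>Since \<open>c\<^sup>2 = y\<^sup>2 + s\<^sup>2\<close>, the bound \<open>s\<^sup>2 \<ge> 1 - y\<^sup>2 / 3\<close> is equivalent to \<open>4 * s\<^sup>2 \<ge> 6 - 2 * c\<^sup>2\<close>, and
what remains is the perfect square \<open>6 * (c - 1)\<^sup>2\<close> plus \<open>2\<close>.\<close>

lemma jump_polynomial_nonneg:
  assumes "y > 0"
  shows "0 \<le> 8 * (y * coth y)\<^sup>2 + 4 * (y * csch y)\<^sup>2 - 12 * (y * coth y) + 2"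
proof -
  define c where "c = y * coth y"
  have "c\<^sup>2 = y\<^sup>2 + (y * csch y)\<^sup>2"
    using coth_square[of y] assms by (simp add: c_def power_mult_distrib algebra_simps)
  then have "8 * c\<^sup>2 + 4 * (y * csch y)\<^sup>2 - 12 * c + 2 \<ge> 6 * c\<^sup>2 - 12 * c + 8"
    using mult_csch_square_ge[OF assms] by simp
  moreover have "6 * c\<^sup>2 - 12 * c + 8 = 6 * (c - 1)\<^sup>2 + 2"
    by (simp add: power2_diff)
  moreover have "6 * (c - 1)\<^sup>2 \<ge> 0" by simp
  ultimately show ?thesis unfolding c_def by linarith
qed

lemma csch_density_nonneg:
  assumes "x > 0"
  shows "csch_density1 x \<ge> 0" "csch_density2 x \<ge> 0" "csch_density3 x \<ge> 0"
proof -
  have y: "pi * x / 2 > 0" using assms by simp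
  have "0 \<le> x\<^sup>2 * csch_density1 x" "0 \<le> x\<^sup>2 * csch_density2 x" "0 \<le> x\<^sup>2 * csch_density3 x"
    unfolding csch_density_normal_forms[OF assms]
    using one_le_mult_coth[OF y] jump_polynomial_nonneg[OF y] by simp_all
  then show "csch_density1 x \<ge> 0" "csch_density2 x \<ge> 0" "csch_density3 x \<ge> 0"
    using assms by (simp_all add: zero_le_mult_iff)
qed

text \<open>The first factor is at most \<open>4 * exp (- y)\<close>, and a quadratic polynomial in \<open>c = y * coth y \<le> 1 + y\<close>
costs only half of this exponent, as \<open>c\<^sup>2 \<le> 16 * exp (y / 2)\<close>. The constant \<open>26 = 8 + 4 + 12 + 2\<close> is the sum of the coefficients of the polynomial of the
third density, and \<open>1664 = 4 * 26 * 16\<close>.\<close>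

lemma csch_weight_bound:
  fixes y p :: real
  assumes y: "y > 0" and p: "\<bar>p\<bar> \<le> 26 * (y * coth y)\<^sup>2"
  shows "(y * csch y)\<^sup>2 * \<bar>p\<bar> \<le> 1664 * exp (- (y / 2))"
proof -
  have "(y * csch y)\<^sup>2 \<le> (2 * exp (- (y / 2)))\<^sup>2"
    using mult_csch_le[OF y] csch_pos[OF y] y by (intro power_mono) auto
  also have "\<dots> = 4 * exp (- y)"
    by (simp add: power_mult_distrib flip: exp_of_nat_mult)
  finally have s: "(y * csch y)\<^sup>2 \<le> 4 * exp (- y)" .
  have "y * coth y \<le> 4 * (1 + y / 4)" using mult_coth_le[OF y] y by simp
  also have "\<dots> \<le> 4 * exp (y / 4)" by (intro mult_left_mono exp_ge_add_one_self) auto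
  finally have "(y * coth y)\<^sup>2 \<le> (4 * exp (y / 4))\<^sup>2"
    using one_le_mult_coth[OF y] by (intro power_mono) auto
  also have "\<dots> = 16 * exp (y / 2)"
    by (simp add: power_mult_distrib flip: exp_of_nat_mult)
  finally have "\<bar>p\<bar> \<le> 26 * (16 * exp (y / 2))" using p by linarith
  with s have "(y * csch y)\<^sup>2 * \<bar>p\<bar> \<le> 4 * exp (- y) * (26 * (16 * exp (y / 2)))"
    by (intro mult_mono) auto
  also have "\<dots> = 1664 * (exp (- y) * exp (y / 2))" by simp
  also have "exp (- y) * exp (y / 2) = exp (- (y / 2))"
    by (simp flip: exp_add)
  finally show ?thesis .
qed

lemma csch_density_decay:
  assumes x: "x > 0"
  shows "x\<^sup>2 * \<bar>csch_density1 x\<bar> \<le> 1664 * exp (- (pi / 4 * x))"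
    and "x\<^sup>2 * \<bar>csch_density2 x\<bar> \<le> 1664 * exp (- (pi / 4 * x))"
    and "x\<^sup>2 * \<bar>csch_density3 x\<bar> \<le> 1664 * exp (- (pi / 4 * x))"
proof -
  define y where "y = pi * x / 2"
  have y: "y > 0" using x by (simp add: y_def)
  define s c where "s = y * csch y" and "c = y * coth y"
  have c: "c \<ge> 1" unfolding c_def by (rule one_le_mult_coth[OF y])
  then have cc: "c \<le> c\<^sup>2" "1 \<le> c\<^sup>2" by (simp_all add: power2_eq_square mult_ge1_I one_le_power)
  have s: "0 \<le> s\<^sup>2" "s\<^sup>2 \<le> c\<^sup>2"
    using coth_square[of y] y by (auto simp: s_def c_def power_mult_distrib intro!: mult_left_mono)
  have pi: "2 / pi \<le> 1" "1 / pi \<le> 1" using pi_gt3 by auto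
  have key: "\<bar>a * s\<^sup>2 * p\<bar> \<le> 1664 * exp (- (pi / 4 * x))"
    if "0 \<le> a" "a \<le> 1" "\<bar>p\<bar> \<le> 26 * c\<^sup>2" for a p
  proof -
    have "\<bar>a * s\<^sup>2 * p\<bar> = a * (s\<^sup>2 * \<bar>p\<bar>)" using that by (simp add: abs_mult)
    also have "\<dots> \<le> 1 * (s\<^sup>2 * \<bar>p\<bar>)" using that by (intro mult_right_mono) auto
    also have "\<dots> \<le> 1664 * exp (- (y / 2))"
      using csch_weight_bound[OF y, of p] that by (simp add: s_def c_def)
    finally show ?thesis by (simp add: y_def)
  qed
  have "\<bar>1\<bar> \<le> 26 * c\<^sup>2" "\<bar>2 * c - 1\<bar> \<le> 26 * c\<^sup>2" "\<bar>8 * c\<^sup>2 + 4 * s\<^sup>2 - 12 * c + 2\<bar> \<le> 26 * c\<^sup>2"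
    using c cc s by linarith+
  note bounds = this
  have nf: "x\<^sup>2 * csch_density1 x = 2 / pi * s\<^sup>2 * 1" "x\<^sup>2 * csch_density2 x = 2 / pi * s\<^sup>2 * (2 * c - 1)"
      "x\<^sup>2 * csch_density3 x = 1 / pi * s\<^sup>2 * (8 * c\<^sup>2 + 4 * s\<^sup>2 - 12 * c + 2)"
    unfolding s_def c_def y_def using csch_density_normal_forms[OF x] by simp_all
  have ab: "x\<^sup>2 * \<bar>k\<bar> = \<bar>x\<^sup>2 * k\<bar>" for k by (simp add: abs_mult)
  show "x\<^sup>2 * \<bar>csch_density1 x\<bar> \<le> 1664 * exp (- (pi / 4 * x))"
    unfolding ab nf by (rule key[OF _ pi(1) bounds(1)]) simp
  show "x\<^sup>2 * \<bar>csch_density2 x\<bar> \<le> 1664 * exp (- (pi / 4 * x))"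
    unfolding ab nf by (rule key[OF _ pi(1) bounds(2)]) simp
  show "x\<^sup>2 * \<bar>csch_density3 x\<bar> \<le> 1664 * exp (- (pi / 4 * x))"
    unfolding ab nf by (rule key[OF _ pi(2) bounds(3)]) simp
qed

lemma borel_measurable_csch [measurable]: "csch \<in> borel_measurable borel"
  unfolding csch_def[abs_def] by (intro borel_measurable_divide borel_measurable_continuous_onI continuous_intros)

lemma borel_measurable_coth [measurable]: "coth \<in> borel_measurable borel"
  unfolding coth_def[abs_def] by (intro borel_measurable_divide borel_measurable_continuous_onI continuous_intros)

lemma set_integrable_exp_minus:
  assumes "a > 0"
  shows "set_integrable lborel {0<..} (\<lambda>x::real. exp (- (a * x)))"
proof -
  have "((\<lambda>x. - exp (- (a * x)) / a) has_real_derivative exp (- (a * x))) (at x)" for x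
    using assms by (auto intro!: derivative_eq_intros)
  moreover have "(((\<lambda>x. - exp (- (a * x)) / a) \<circ> real_of_ereal) \<longlongrightarrow> - exp (- (a * 0)) / a) (at_right 0)"
    unfolding zero_ereal_def ereal_tendsto_simps using assms by (intro tendsto_intros) auto
  moreover have "((\<lambda>x. - exp (- (a * x)) / a) \<longlongrightarrow> 0) at_top"
    using assms by real_asymp
  then have "(((\<lambda>x. - exp (- (a * x)) / a) \<circ> real_of_ereal) \<longlongrightarrow> 0) (at_left \<infinity>)"
    by (simp add: ereal_tendsto_simps)
  ultimately have "set_integrable lborel (einterval 0 \<infinity>) (\<lambda>x. exp (- (a * x)))"
    by (intro interval_integral_FTC_nonneg(1)) (auto intro!: continuous_intros)
  then show ?thesis
    by (simp add: einterval_def greaterThan_def)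
qed

lemma set_integrable_of_exp_decay:
  fixes k :: "real \<Rightarrow> real"
  assumes [measurable]: "k \<in> borel_measurable borel" and "a > 0"
    and k: "\<And>x. x > 0 \<Longrightarrow> x\<^sup>2 * \<bar>k x\<bar> \<le> C * exp (- (a * x))"
  shows "set_integrable lborel {0<..} (\<lambda>x. x\<^sup>2 * k x)"
  unfolding set_integrable_def
proof (rule Bochner_Integration.integrable_bound)
  show "integrable lborel (\<lambda>x. C * (indicator {0<..} x *\<^sub>R exp (- (a * x))))"
    using set_integrable_exp_minus[OF \<open>a > 0\<close>] by (auto simp: set_integrable_def)
  show "AE x in lborel. norm (indicator {0<..} x *\<^sub>R (x\<^sup>2 * k x)) \<le> norm (C * (indicator {0<..} x *\<^sub>R exp (- (a * x))))"
    using order.trans[OF k abs_ge_self] by (intro AE_I2) (auto simp: indicator_def abs_mult)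
qed measurable

lemma csch_density_integrable:
  shows "set_integrable lborel {0<..} (\<lambda>x. x\<^sup>2 * csch_density1 x)"
    and "set_integrable lborel {0<..} (\<lambda>x. x\<^sup>2 * csch_density2 x)"
    and "set_integrable lborel {0<..} (\<lambda>x. x\<^sup>2 * csch_density3 x)"
proof -
  have m: "csch_density1 \<in> borel_measurable borel" "csch_density2 \<in> borel_measurable borel"
      "csch_density3 \<in> borel_measurable borel"
    unfolding csch_density_defs[abs_def] by measurable
  show "set_integrable lborel {0<..} (\<lambda>x. x\<^sup>2 * csch_density1 x)"
    and "set_integrable lborel {0<..} (\<lambda>x. x\<^sup>2 * csch_density2 x)"
    and "set_integrable lborel {0<..} (\<lambda>x. x\<^sup>2 * csch_density3 x)"
    using csch_density_decay by (auto intro!: set_integrable_of_exp_decay[where a = "pi / 4"] m)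
qed

lemma has_real_derivative_csch [derivative_intros]:
  assumes "(f has_real_derivative D) (at x within A)" "f x \<noteq> 0"
  shows "((\<lambda>x. csch (f x)) has_real_derivative - csch (f x) * coth (f x) * D) (at x within A)"
  unfolding csch_def coth_def using assms
  by (auto intro!: derivative_eq_intros simp: power2_eq_square field_simps)

lemma has_real_derivative_coth [derivative_intros]:
  assumes "(f has_real_derivative D) (at x within A)" "f x \<noteq> 0"
  shows "((\<lambda>x. coth (f x)) has_real_derivative - (csch (f x))\<^sup>2 * D) (at x within A)"
proof -
  have "((\<lambda>x. cosh (f x) / sinh (f x)) has_real_derivative
      D * ((sinh (f x))\<^sup>2 - (cosh (f x))\<^sup>2) / (sinh (f x))\<^sup>2) (at x within A)"
    using assms by (auto intro!: derivative_eq_intros simp: power2_eq_square algebra_simps)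
  then show ?thesis
    by (simp add: coth_def csch_def cosh_square_eq power_divide)
qed

text \<open>The three densities form a chain under \<open>k \<mapsto> - (x * k)'\<close>, just as the three exponents form a chain
under \<open>t * d/dt\<close>.\<close>

lemma csch_density_derivatives:
  assumes "x > 0"
  shows "((\<lambda>x. x * csch_density1 x) has_real_derivative - csch_density2 x) (at x)"
    and "((\<lambda>x. x * csch_density2 x) has_real_derivative - csch_density3 x) (at x)"
  unfolding csch_density_defs using assms
  by (auto intro!: derivative_eq_intros simp: power2_eq_square field_simps)

lemma csch_density_isCont:
  assumes "x > 0"
  shows "isCont csch_density2 x" "isCont csch_density3 x"
proof -
  have "isCont (\<lambda>x. csch (pi * x / 2)) x" "isCont (\<lambda>x. coth (pi * x / 2)) x"
    using assms unfolding csch_def coth_def by (auto intro!: continuous_intros)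
  then show "isCont csch_density2 x" "isCont csch_density3 x"
    unfolding csch_density_defs[abs_def] by (auto intro!: continuous_intros)
qed

text \<open>The derivative of the exponent is computed from its closed form \<open>\<Phi>\<close>. This describes the exponent
off \<open>0\<close> only, but the punctured line is open.\<close>

lemma levy_integral_transform:
  assumes int: "set_integrable lborel {0<..} (\<lambda>x. x\<^sup>2 * k x)" "set_integrable lborel {0<..} (\<lambda>x. x\<^sup>2 * l x)"
    and deriv: "\<And>x. x > 0 \<Longrightarrow> ((\<lambda>x. x * k x) has_real_derivative - l x) (at x)"
    and cont: "\<And>x. x > 0 \<Longrightarrow> isCont l x"
    and bound: "\<And>x. x > 0 \<Longrightarrow> x\<^sup>2 * \<bar>k x\<bar> \<le> C"
    and val: "\<And>t. t \<noteq> 0 \<Longrightarrow> levy_integral k t = \<Phi> t"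
    and D: "(\<Phi> has_real_derivative D) (at t)" and t: "t \<noteq> 0"
  shows "levy_integral l t = t * D"
proof (rule levy_integral_dilation[OF int deriv cont bound])
  show "(levy_integral k has_real_derivative D) (at t)"
  proof (rule has_field_derivative_transform_within_open[OF D])
    show "open (- {0 :: real})" "t \<in> - {0}" using t by auto
  qed (simp add: val)
qed

section \<open>The identities\<close>

text \<open>
An integral exponent is continuous and vanishes at \<open>0\<close>, so a closed form valid off \<open>0\<close> extends by
its limit and the extension is again the integral.\<close>

lemma levy_integral_closed_form:
  assumes k: "set_integrable lborel {0<..} (\<lambda>x. x\<^sup>2 * k x)" and nonneg: "\<And>x. x > 0 \<Longrightarrow> k x \<ge> 0"
    and val: "\<And>t. t \<noteq> 0 \<Longrightarrow> levy_integral k t = \<Phi> t"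
  shows "(\<exists>L. (\<Phi> \<longlongrightarrow> L) (at 0)) \<and>
    (\<forall>t. set_integrable lborel {0<..} (\<lambda>x. (cos (t * x) - 1) * k x) \<and>
      (LBINT x:{0<..}. (cos (t * x) - 1) * k x) = lim_at_0 \<Phi> t) \<and>
    levy_exponent (\<lambda>t. complex_of_real (lim_at_0 \<Phi> t))"
proof -
  have zero: "levy_integral k 0 = 0"
    by (simp add: levy_integral_def)
  have "isCont (levy_integral k) 0"
    using has_real_derivative_levy_integral[OF k] by (rule DERIV_isCont)
  then have "(levy_integral k \<longlongrightarrow> 0) (at 0)"
    by (simp add: isCont_def zero)
  moreover have "eventually (\<lambda>t. levy_integral k t = \<Phi> t) (at 0)"
    using val by (auto simp: eventually_at_filter)
  ultimately have lim: "(\<Phi> \<longlongrightarrow> 0) (at 0)"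
    by (rule Lim_transform_eventually)
  then have "Lim (at 0) \<Phi> = 0"
    by (intro tendsto_Lim) auto
  then have eq: "lim_at_0 \<Phi> t = levy_integral k t" for t
    using val zero by (simp add: lim_at_0_def)
  show ?thesis
    using lim set_integrable_levy[OF k] levy_exponent_levy_integral[OF k nonneg]
    by (auto simp: eq levy_integral_def)
qed

lemma levy_integral_csch_density1:
  assumes "t \<noteq> 0"
  shows "levy_integral csch_density1 t = 1 - t * coth t"
  using levy_integral_csch_square[OF assms] by (simp add: levy_integral_def csch_density1_def)

lemma levy_integral_csch_density2:
  assumes "t \<noteq> 0"
  shows "levy_integral csch_density2 t = t\<^sup>2 * (csch t)\<^sup>2 - t * coth t"
proof -
  have bound: "x\<^sup>2 * \<bar>csch_density1 x\<bar> \<le> 1664" if "x > 0" for x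
    using csch_density_decay(1)[OF that] that by (auto intro: order.trans)
  have "((\<lambda>t. 1 - t * coth t) has_real_derivative t * (csch t)\<^sup>2 - coth t) (at t)"
    using assms by (auto intro!: derivative_eq_intros)
  from levy_integral_transform[OF csch_density_integrable(1,2) csch_density_derivatives(1)
      csch_density_isCont(1) bound levy_integral_csch_density1 this assms]
  show ?thesis by (simp add: power2_eq_square algebra_simps)
qed

lemma levy_integral_csch_density3:
  assumes "t \<noteq> 0"
  shows "levy_integral csch_density3 t =
    3 * t\<^sup>2 * (csch t)\<^sup>2 - t * coth t * (2 * t\<^sup>2 * (csch t)\<^sup>2 + 1)"
proof -
  have bound: "x\<^sup>2 * \<bar>csch_density2 x\<bar> \<le> 1664" if "x > 0" for x
    using csch_density_decay(2)[OF that] that by (auto intro: order.trans)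
  have "((\<lambda>t. t\<^sup>2 * (csch t)\<^sup>2 - t * coth t) has_real_derivative
      3 * t * (csch t)\<^sup>2 - 2 * t\<^sup>2 * (csch t)\<^sup>2 * coth t - coth t) (at t)"
    using assms by (auto intro!: derivative_eq_intros simp: power2_eq_square algebra_simps)
  from levy_integral_transform[OF csch_density_integrable(2,3) csch_density_derivatives(2)
      csch_density_isCont(2) bound levy_integral_csch_density2 this assms]
  show ?thesis by (simp add: power2_eq_square algebra_simps)
qed

lemmas csch_identities =
  levy_integral_closed_form[OF csch_density_integrable(1) csch_density_nonneg(1)
    levy_integral_csch_density1, unfolded csch_density1_def]
  levy_integral_closed_form[OF csch_density_integrable(2) csch_density_nonneg(2)
    levy_integral_csch_density2, unfolded csch_density2_def]
  levy_integral_closed_form[OF csch_density_integrable(3) csch_density_nonneg(3)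
    levy_integral_csch_density3, unfolded csch_density3_def]

theorem lemma1:
  shows
    "(let rhs = (\<lambda>t. 1 - t * coth t);
          integrand = (\<lambda>t x. (cos (t * x) - 1) * (pi / 2 * (csch (pi * x / 2))\<^sup>2))
      in (\<exists>L. (rhs \<longlongrightarrow> L) (at 0)) \<and>
         (\<forall>t. set_integrable lborel {0<..} (integrand t) \<and>
              (LBINT x:{0<..}. integrand t x) = lim_at_0 rhs t) \<and>
         levy_exponent (\<lambda>t. complex_of_real (lim_at_0 rhs t)))
     \<and>
     (let rhs = (\<lambda>t. t\<^sup>2 * (csch t)\<^sup>2 - t * coth t);
          integrand = (\<lambda>t x. (cos (t * x) - 1) * (pi / 2 * (csch (pi * x / 2))\<^sup>2 * (pi * x * coth (pi * x / 2) - 1)))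
      in (\<exists>L. (rhs \<longlongrightarrow> L) (at 0)) \<and>
         (\<forall>t. set_integrable lborel {0<..} (integrand t) \<and>
              (LBINT x:{0<..}. integrand t x) = lim_at_0 rhs t) \<and>
         levy_exponent (\<lambda>t. complex_of_real (lim_at_0 rhs t)))
     \<and>
     (let rhs = (\<lambda>t. 3 * t\<^sup>2 * (csch t)\<^sup>2 - t * coth t * (2 * t\<^sup>2 * (csch t)\<^sup>2 + 1));
          integrand = (\<lambda>t x. (cos (t * x) - 1) * (pi / 4 * (csch (pi * x / 2))\<^sup>2 *
             (2 * pi\<^sup>2 * x\<^sup>2 * (coth (pi * x / 2))\<^sup>2
              + pi\<^sup>2 * x\<^sup>2 * (csch (pi * x / 2))\<^sup>2
              - 6 * pi * x * coth (pi * x / 2) + 2)))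
      in (\<exists>L. (rhs \<longlongrightarrow> L) (at 0)) \<and>
         (\<forall>t. set_integrable lborel {0<..} (integrand t) \<and>
              (LBINT x:{0<..}. integrand t x) = lim_at_0 rhs t) \<and>
         levy_exponent (\<lambda>t. complex_of_real (lim_at_0 rhs t)))"
  unfolding Let_def
  by (rule conjI[OF csch_identities(1) conjI[OF csch_identities(2,3)]])

end
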